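(* Let $h(x)=\int_0^\infty g(xy)g(y)\,dy$ with $g$ a real-valued function in $C_c^\infty(0,\infty)$ whose support is contained in $(\sqrt{\mu},\mu^{-1/2})$ for a number $0<\mu<1$, and such that $\widehat h(0)=\widehat h(1)=0$. Then $$\sum_{k_1,k_2,l_1,l_2\in\mathbb N_S}\frac{\mu(k_1)\mu(k_2)}{k_1k_2}\int_1^\infty\log v\,\cos\frac{2\pi l_1v}{k_1}\left(\int_1^\infty h(u)\cos\frac{2\pi l_2uv}{k_2}\,du\right)dv\ \ge\ 0 .$$
   Context: Here $\widehat h(s)=\int_0^\infty h(x)x^{s-1}\,dx$. Note $h(x)=0$ for $x\notin(\mu,\mu^{-1})$. $\mathbb N_S$ is the set of all positive integers (including $1$) that are products of primes $p<\mu^{-1}$, where $\mu$ is the number in the support condition on $g$. In the sum, $\mu(k)$ (with an integer argument) denotes the Möbius function, not the number $\mu$. The integral over $v$ is an improper (conditionally convergent) integral. *)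

theory Defs
  imports
    "HOL-Analysis.Analysis"
    "HOL-Computational_Algebra.Computational_Algebra"
begin

text \<open>
  Functions on \<open>(0, \<infinity>)\<close> are total functions on the reals whose values on
  \<open>(-\<infinity>, 0]\<close> are irrelevant. The closure below is taken in the whole real line;
  that it is compact and contained in \<open>(0, \<infinity>)\<close> is equivalent to compactness of
  the closure relative to \<open>(0, \<infinity>)\<close>.
\<close>

definition supp_pos :: "(real \<Rightarrow> real) \<Rightarrow> real set" where
  "supp_pos g = closure {x. 0 < x \<and> g x \<noteq> 0}"

definition Cc_infinity_pos :: "(real \<Rightarrow> real) set" where
  "Cc_infinity_pos =
     {g. (\<forall>n. \<forall>x>0. (deriv ^^ n) g field_differentiable at x) \<and>
         compact (supp_pos g) \<and> supp_pos g \<subseteq> {0<..}}"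

definition mellin :: "(real \<Rightarrow> real) \<Rightarrow> complex \<Rightarrow> complex" where
  "mellin h s =
     (LINT x:{0<..}|lborel. complex_of_real (h x) * complex_of_real x powr (s - 1))"

definition moebius :: "nat \<Rightarrow> int" where
  "moebius n = (if squarefree n then (-1) ^ card (prime_factors n) else 0)"

text \<open>The parameter \<open>B\<close> is the bound on the primes, to be instantiated with \<open>1 / \<mu>\<close>.\<close>

definition N_S :: "real \<Rightarrow> nat set" where
  "N_S B = {n. 0 < n \<and> (\<forall>p. prime p \<and> p dvd n \<longrightarrow> real p < B)}"

definition inner_integral :: "(real \<Rightarrow> real) \<Rightarrow> nat \<Rightarrow> nat \<Rightarrow> real \<Rightarrow> real" where
  "inner_integral h k l v =
     (LINT u:{1..}|lborel. h u * cos (2 * pi * real l * u * v / real k))"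

text \<open>
  The outer integral converges only conditionally, so it is the limit of the integrals over
  \<open>[1, T]\<close>. The constant \<^const>\<open>Lim\<close> is unspecified if there is no limit; existence has to be
  stated separately.
\<close>

definition outer_partial ::
    "(real \<Rightarrow> real) \<Rightarrow> nat \<Rightarrow> nat \<Rightarrow> nat \<Rightarrow> nat \<Rightarrow> real \<Rightarrow> real" where
  "outer_partial h k1 k2 l1 l2 T =
     (LINT v:{1..T}|lborel.
        ln v * cos (2 * pi * real l1 * v / real k1) * inner_integral h k2 l2 v)"

definition outer_integral ::
    "(real \<Rightarrow> real) \<Rightarrow> nat \<Rightarrow> nat \<Rightarrow> nat \<Rightarrow> nat \<Rightarrow> real" where
  "outer_integral h k1 k2 l1 l2 = Lim at_top (outer_partial h k1 k2 l1 l2)"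

definition sum_term :: "(real \<Rightarrow> real) \<Rightarrow> nat \<times> nat \<times> nat \<times> nat \<Rightarrow> real" where
  "sum_term h = (\<lambda>(k1, k2, l1, l2).
     of_int (moebius k1) * of_int (moebius k2) / (real k1 * real k2) *
       outer_integral h k1 k2 l1 l2)"

end

theory Submission
  imports Defs
begin

text \<open>
  The sum is a quadratic form in the cosine kernels that is positive for a simple reason.
  Let \<open>\<Phi>(v) = \<Sum> c\<^sub>i cos (a\<^sub>i v)\<close> be a finite sum; below, \<open>i\<close> runs over pairs \<open>(k, l)\<close> with
  \<open>a\<^sub>i = 2 \<pi> l / k\<close> and \<open>c\<^sub>i = \<mu>(k) / k\<close>. For \<open>s > 0\<close> put \<open>G(y) = g(y) \<Phi>(s y)\<close> and
  \<open>H(y) = \<integral>\<^sub>y\<^sup>\<infinity> G\<close>. As \<open>G H\<close> is the derivative of \<open>- H\<^sup>2 / 2\<close>, integration by parts gives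
  \<open>\<integral> G(y) log\<^sup>+(s y) H(y) dy = 1/2 \<integral>\<^bsub>y > 1/s\<^esub> H(y)\<^sup>2 dy / y \<ge> 0\<close>
  (\<open>log_kernel_nonneg\<close>).
  Integrate this over \<open>0 < s < M\<close>, substitute \<open>v = s y\<close> for \<open>s\<close>, and write the variable of the
  integral \<open>H\<close> as \<open>u y\<close>: with \<open>f\<^sub>y(u) = g(u y)\<close> the result is
  \<open>0 \<le> \<integral> g(y) \<integral>\<^sub>1\<^bsup>M y\<^esup> log v \<Phi>(v) \<integral>\<^sub>1\<^sup>\<infinity> f\<^sub>y(u) \<Phi>(u v) du dv dy\<close>.
  Since \<open>h = \<integral> g(y) f\<^sub>y dy\<close>, replacing the limit \<open>M y\<close> by some \<open>T\<close> that does not depend on \<open>y\<close>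
  turns the right-hand side into the quadratic form of the integrals over \<open>[1, T]\<close> in the theorem.

  The change of the upper limit costs nothing in the limit because the integrals over \<open>v\<close>
  converge uniformly in \<open>y\<close>. Two integrations by parts in \<open>u\<close> leave a main term
  \<open>sin (b v) / (b v)\<close> and a remainder of order \<open>(b v)\<^sup>-\<^sup>2\<close>; after
  multiplication by \<open>cos (a v)\<close> only the frequencies \<open>b u \<plusminus> a\<close> remain, and oscillation bounds the
  tail beyond \<open>x\<close> by a constant times \<open>(2 + log x) / (x sqrt (a b))\<close>, provided that \<open>a\<close>, \<open>b\<close> and
  a nonzero \<open>a - b\<close> stay away from \<open>0\<close> (\<open>log_pairing_cosine_bound\<close>).

  The same bound at \<open>x = 1\<close> makes the sum converge absolutely. The Moebius function leaves only
  finitely many \<open>k\<^sub>1, k\<^sub>2\<close>, so that the frequencies have a uniform gap, and the sum of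
  \<open>1 / sqrt l\<close> over the integers \<open>l\<close> composed of finitely many primes is finite. Hence the
  infinite sum is a limit of sums over boxes \<open>X \<times> X \<times> X \<times> X\<close> with \<open>X\<close> finite, each of which is
  one of the nonnegative quadratic forms above.
\<close>

section \<open>Oscillatory integrals with logarithmic amplitude\<close>

text \<open>
  An antiderivative of \<open>- (1 + ln v) / v\<^sup>2\<close>, and at the same time a bound for \<open>ln v / v\<close>. It
  therefore dominates both the boundary terms and the remaining integral when an integral of
  \<open>ln v / v\<close> or \<open>ln v / v\<^sup>2\<close> against an oscillating factor is integrated by parts.
\<close>
definition tail_bound :: "real \<Rightarrow> real" where
  "tail_bound x = (2 + ln x) / x"

lemma tail_bound_pos: "1 \<le> x \<Longrightarrow> 0 < tail_bound x"
  by (simp add: tail_bound_def add_pos_nonneg)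

lemma tendsto_tail_bound: "(tail_bound \<longlongrightarrow> 0) at_top"
proof -
  have "((\<lambda>x::real. 2 / x + ln x / x) \<longlongrightarrow> 0 + 0) at_top"
    by (intro tendsto_add ln_x_over_x_tendsto_0 tendsto_divide_0[OF tendsto_const]
        filterlim_at_top_imp_at_infinity filterlim_ident)
  then show ?thesis by (simp add: tail_bound_def[abs_def] add_divide_distrib)
qed

lemma has_integral_tail_bound:
  assumes "1 \<le> x" "x \<le> T"
  shows "((\<lambda>v. (1 + ln v) / v\<^sup>2) has_integral (tail_bound x - tail_bound T)) {x..T}"
proof -
  have "((\<lambda>v. (1 + ln v) / v\<^sup>2) has_integral (- tail_bound T - - tail_bound x)) {x..T}"
  proof (rule fundamental_theorem_of_calculus[OF assms(2)])
    fix t assume t: "t \<in> {x..T}"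
    with assms have "t > 0" by auto
    then have "((\<lambda>v. - tail_bound v) has_real_derivative (1 + ln t) / t\<^sup>2) (at t within {x..T})"
      unfolding tail_bound_def
      by (auto intro!: derivative_eq_intros simp: field_simps power2_eq_square)
    then show "((\<lambda>v. - tail_bound v) has_vector_derivative (1 + ln t) / t\<^sup>2) (at t within {x..T})"
      by (simp add: has_real_derivative_iff_has_vector_derivative)
  qed
  then show ?thesis by simp
qed

text \<open>
  Integration by parts moves the derivative from the bounded primitive \<open>\<phi>\<close> of the oscillating
  factor to the amplitude \<open>w\<close>. The two boundary terms contribute at most
  \<open>tail_bound x + tail_bound T\<close>, the integral of \<open>\<bar>w'\<bar>\<close> at most
  \<open>2 (tail_bound x - tail_bound T)\<close>, and the primitive contributes the factor \<open>r\<close>.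
\<close>
lemma oscillatory_integral_bound:
  fixes w w' \<phi> \<psi> :: "real \<Rightarrow> real"
  assumes x: "1 \<le> x" "x \<le> T"
    and w: "\<And>v. v \<ge> 1 \<Longrightarrow> (w has_real_derivative w' v) (at v)"
    and wb: "\<And>v. v \<ge> 1 \<Longrightarrow> \<bar>w v\<bar> \<le> tail_bound v"
    and w'b: "\<And>v. v \<ge> 1 \<Longrightarrow> \<bar>w' v\<bar> \<le> 2 * ((1 + ln v) / v\<^sup>2)"
    and w'c: "continuous_on {1..} w'"
    and \<phi>: "\<And>v. (\<phi> has_real_derivative \<psi> v) (at v)"
    and \<phi>b: "\<And>v. \<bar>\<phi> v\<bar> \<le> r"
    and \<psi>c: "continuous_on UNIV \<psi>"
  shows "\<bar>integral {x..T} (\<lambda>v. w v * \<psi> v)\<bar> \<le> 6 * tail_bound x * r"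
proof -
  have \<phi>c: "continuous_on A \<phi>" for A
    using \<phi> by (meson DERIV_isCont continuous_at_imp_continuous_on)
  have w'c2: "continuous_on {x..T} w'" using x by (intro continuous_on_subset[OF w'c]) auto
  have "((\<lambda>v. w' v * \<phi> v + w v * \<psi> v) has_integral (w T * \<phi> T - w x * \<phi> x)) {x..T}"
  proof (rule fundamental_theorem_of_calculus[OF x(2)])
    fix t assume "t \<in> {x..T}"
    with x have "t \<ge> 1" by auto
    from DERIV_mult[OF w[OF this] \<phi>[of t]]
    have "((\<lambda>v. w v * \<phi> v) has_real_derivative w' t * \<phi> t + w t * \<psi> t) (at t)"
      by (simp add: algebra_simps)
    then show "((\<lambda>v. w v * \<phi> v) has_vector_derivative w' t * \<phi> t + w t * \<psi> t) (at t within {x..T})"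
      by (simp add: has_real_derivative_iff_has_vector_derivative has_vector_derivative_at_within)
  qed
  moreover have i1: "(\<lambda>v. w' v * \<phi> v) integrable_on {x..T}"
    by (intro integrable_continuous_real continuous_intros w'c2 \<phi>c)
  ultimately have "((\<lambda>v. w v * \<psi> v) has_integral
      (w T * \<phi> T - w x * \<phi> x) - integral {x..T} (\<lambda>v. w' v * \<phi> v)) {x..T}"
    using has_integral_diff[OF _ integrable_integral[OF i1]] by force
  then have eq: "integral {x..T} (\<lambda>v. w v * \<psi> v) =
      (w T * \<phi> T - w x * \<phi> x) - integral {x..T} (\<lambda>v. w' v * \<phi> v)"
    by (rule integral_unique)
  have r: "r \<ge> 0" using \<phi>b[of 0] by linarith
  have hi: "((\<lambda>v. 2 * ((1 + ln v) / v\<^sup>2) * r) has_integral 2 * (tail_bound x - tail_bound T) * r) {x..T}"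
    by (intro has_integral_mult_left has_integral_mult_right has_integral_tail_bound x)
  have "norm (integral {x..T} (\<lambda>v. w' v * \<phi> v)) \<le> integral {x..T} (\<lambda>v. 2 * ((1 + ln v) / v\<^sup>2) * r)"
  proof (rule integral_norm_bound_integral[OF i1])
    show "(\<lambda>v. 2 * ((1 + ln v) / v\<^sup>2) * r) integrable_on {x..T}" using hi by blast
    fix v assume "v \<in> {x..T}"
    with x have "v \<ge> 1" by auto
    then show "norm (w' v * \<phi> v) \<le> 2 * ((1 + ln v) / v\<^sup>2) * r"
      unfolding real_norm_def abs_mult by (intro mult_mono w'b \<phi>b) auto
  qed
  also have "\<dots> = 2 * (tail_bound x - tail_bound T) * r" using hi by (rule integral_unique)
  finally have b1: "\<bar>integral {x..T} (\<lambda>v. w' v * \<phi> v)\<bar> \<le> 2 * (tail_bound x - tail_bound T) * r" by simp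
  have b2: "\<bar>w T * \<phi> T\<bar> \<le> tail_bound T * r"
    unfolding abs_mult using x tail_bound_pos[of T] by (intro mult_mono wb \<phi>b) auto
  have b3: "\<bar>w x * \<phi> x\<bar> \<le> tail_bound x * r"
    unfolding abs_mult using x tail_bound_pos[of x] by (intro mult_mono wb \<phi>b) auto
  have b4: "0 \<le> tail_bound T * r" "0 \<le> tail_bound x * r"
    using tail_bound_pos[of T] tail_bound_pos[of x] x r by auto
  show ?thesis unfolding eq using b1 b2 b3 b4 by (simp add: algebra_simps)
qed

text \<open>
  Resonance is harmless here: at \<open>c = 0\<close> the integral vanishes, in agreement with \<open>1 / 0 = 0\<close>.
\<close>
lemma log_sine_integral_bound:
  assumes "1 \<le> x" "x \<le> T"
  shows "\<bar>integral {x..T} (\<lambda>v. ln v / v * sin (c * v))\<bar> \<le> 6 * tail_bound x * (1 / \<bar>c\<bar>)"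
proof (cases "c = 0")
  case False
  show ?thesis
  proof (rule oscillatory_integral_bound[OF assms,
        where w' = "\<lambda>v. (1 - ln v) / v\<^sup>2" and \<phi> = "\<lambda>v. - cos (c * v) / c"])
    fix v :: real assume v: "v \<ge> 1"
    show "((\<lambda>v. ln v / v) has_real_derivative (1 - ln v) / v\<^sup>2) (at v)"
      using v by (auto intro!: derivative_eq_intros simp: field_simps power2_eq_square)
    show "\<bar>ln v / v\<bar> \<le> tail_bound v"
      using v by (simp add: tail_bound_def divide_simps)
    have "\<bar>1 - ln v\<bar> \<le> 2 * (1 + ln v)" using ln_ge_zero[OF v] unfolding abs_le_iff by simp
    then show "\<bar>(1 - ln v) / v\<^sup>2\<bar> \<le> 2 * ((1 + ln v) / v\<^sup>2)"
      by (simp add: divide_right_mono)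
  next
    show "continuous_on {1..} (\<lambda>v::real. (1 - ln v) / v\<^sup>2)"
      by (intro continuous_intros) auto
    fix v
    show "((\<lambda>v. - cos (c * v) / c) has_real_derivative sin (c * v)) (at v)"
      using False by (auto intro!: derivative_eq_intros)
    show "\<bar>- cos (c * v) / c\<bar> \<le> 1 / \<bar>c\<bar>" by (simp add: divide_right_mono)
    show "continuous_on UNIV (\<lambda>v. sin (c * v))" by (intro continuous_intros)
  qed
qed simp

lemma log_over_square_le:
  fixes v :: real
  assumes "v \<ge> 1"
  shows "ln v / v\<^sup>2 \<le> (1 + ln v) / v\<^sup>2" "ln v / v\<^sup>2 \<ge> 0" "\<bar>ln v / v\<^sup>2\<bar> \<le> tail_bound v"
proof -
  show 1: "ln v / v\<^sup>2 \<le> (1 + ln v) / v\<^sup>2" "ln v / v\<^sup>2 \<ge> 0"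
    using assms by (auto simp: divide_simps)
  have "ln v / v\<^sup>2 \<le> ln v / v"
    using assms by (intro divide_left_mono) (auto simp: power2_eq_square)
  also have "\<dots> \<le> tail_bound v" using assms by (simp add: tail_bound_def divide_simps)
  finally show "\<bar>ln v / v\<^sup>2\<bar> \<le> tail_bound v" using 1 by simp
qed

lemma log_cosine_integral_bound:
  assumes "1 \<le> x" "x \<le> T" "c \<noteq> 0"
  shows "\<bar>integral {x..T} (\<lambda>v. ln v / v\<^sup>2 * cos (c * v))\<bar> \<le> 6 * tail_bound x * (1 / \<bar>c\<bar>)"
proof (rule oscillatory_integral_bound[OF assms(1,2),
        where w' = "\<lambda>v. (1 - 2 * ln v) / v^3" and \<phi> = "\<lambda>v. sin (c * v) / c"])
  fix v :: real assume v: "v \<ge> 1"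
  show "((\<lambda>v. ln v / v\<^sup>2) has_real_derivative (1 - 2 * ln v) / v^3) (at v)"
    using v by (auto intro!: derivative_eq_intros simp: field_simps power2_eq_square power3_eq_cube)
  show "\<bar>ln v / v\<^sup>2\<bar> \<le> tail_bound v" using log_over_square_le[OF v] by simp
  have "\<bar>1 - 2 * ln v\<bar> \<le> 2 * (1 + ln v)" using ln_ge_zero[OF v] unfolding abs_le_iff by simp
  moreover have "v\<^sup>2 \<le> v^3" using v by (intro power_increasing) auto
  ultimately have "\<bar>1 - 2 * ln v\<bar> / v^3 \<le> (2 * (1 + ln v)) / v\<^sup>2"
    using v by (intro frac_le) auto
  then show "\<bar>(1 - 2 * ln v) / v^3\<bar> \<le> 2 * ((1 + ln v) / v\<^sup>2)" using v by simp
next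
  show "continuous_on {1..} (\<lambda>v::real. (1 - 2 * ln v) / v^3)"
    by (intro continuous_intros) auto
  fix v
  show "((\<lambda>v. sin (c * v) / c) has_real_derivative cos (c * v)) (at v)"
    using assms by (auto intro!: derivative_eq_intros)
  show "\<bar>sin (c * v) / c\<bar> \<le> 1 / \<bar>c\<bar>" by (simp add: divide_right_mono)
  show "continuous_on UNIV (\<lambda>v. cos (c * v))" by (intro continuous_intros)
qed

text \<open>
  For cosines the resonance \<open>c = 0\<close> is not harmless, but the amplitude \<open>ln v / v\<^sup>2\<close> is
  integrable, which gives a bound that is uniform in \<open>c\<close>.
\<close>
lemma log_cosine_integral_trivial_bound:
  assumes "1 \<le> x" "x \<le> T"
  shows "\<bar>integral {x..T} (\<lambda>v. ln v / v\<^sup>2 * cos (c * v))\<bar> \<le> tail_bound x"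
proof -
  have hi: "((\<lambda>v. (1 + ln v) / v\<^sup>2) has_integral (tail_bound x - tail_bound T)) {x..T}"
    by (intro has_integral_tail_bound assms)
  have "norm (integral {x..T} (\<lambda>v. ln v / v\<^sup>2 * cos (c * v))) \<le> integral {x..T} (\<lambda>v. (1 + ln v) / v\<^sup>2)"
  proof (rule integral_norm_bound_integral)
    show "(\<lambda>v. ln v / v\<^sup>2 * cos (c * v)) integrable_on {x..T}"
      using assms by (intro integrable_continuous_real continuous_intros) auto
    show "(\<lambda>v. (1 + ln v) / v\<^sup>2) integrable_on {x..T}" using hi by blast
    fix v assume "v \<in> {x..T}"
    with assms have v: "v \<ge> 1" by auto
    have "norm (ln v / v\<^sup>2 * cos (c * v)) \<le> (ln v / v\<^sup>2) * 1"
      unfolding real_norm_def abs_mult using log_over_square_le[OF v] by (intro mult_mono) auto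
    with log_over_square_le[OF v] show "norm (ln v / v\<^sup>2 * cos (c * v)) \<le> (1 + ln v) / v\<^sup>2" by linarith
  qed
  also have "\<dots> = tail_bound x - tail_bound T" using hi by (rule integral_unique)
  finally show ?thesis using tail_bound_pos[of T] assms by simp
qed

section \<open>Decay of the pairing of two cosines\<close>

text \<open>
  This is the setting for the function \<open>g\<close> of the theorem after its extension by zero to the
  whole line. The interval \<open>[m, Y]\<close> is the range over which \<open>g\<close> is integrated, and the ratio \<open>U\<close>
  is chosen so that \<open>u \<mapsto> g (u * y)\<close> vanishes beyond \<open>U\<close> for every \<open>y \<ge> m\<close>.
\<close>
locale smooth_bump =
  fixes g g' g'' :: "real \<Rightarrow> real" and m Y U :: real
  assumes m_pos: "0 < m" and m_less: "m < Y" and U_eq: "U = Y / m"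
    and g_deriv: "\<And>x. (g has_real_derivative g' x) (at x)"
    and g'_deriv: "\<And>x. (g' has_real_derivative g'' x) (at x)"
    and g''_cont: "continuous_on UNIV g''"
    and g_zero: "\<And>x. x \<ge> Y \<Longrightarrow> g x = 0"
    and g'_zero: "\<And>x. x \<ge> Y \<Longrightarrow> g' x = 0"
begin

text \<open>
  The integral over \<open>u\<close> in the theorem, with \<open>h\<close> replaced by the dilate \<open>u \<mapsto> g (u * y)\<close> and the
  cosine by an arbitrary kernel.
\<close>
definition cutoff_transform :: "(real \<Rightarrow> real) \<Rightarrow> real \<Rightarrow> real \<Rightarrow> real" where
  "cutoff_transform \<Psi> y v = integral {1..U} (\<lambda>u. g (u * y) * \<Psi> (u * v))"

definition log_pairing :: "(real \<Rightarrow> real) \<Rightarrow> (real \<Rightarrow> real) \<Rightarrow> real \<Rightarrow> real \<Rightarrow> real \<Rightarrow> real" where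
  "log_pairing \<Phi> \<Psi> x T y = integral {x..T} (\<lambda>v. ln v * \<Phi> v * cutoff_transform \<Psi> y v)"

lemma U_gt_1: "1 < U"
  using m_pos m_less by (simp add: U_eq)

lemma Y_le_U_times: "m \<le> y \<Longrightarrow> Y \<le> U * y"
  using m_pos m_less by (simp add: U_eq field_simps)

lemma g_cont: "continuous_on UNIV g"
  using g_deriv by (meson DERIV_isCont continuous_at_imp_continuous_on)

text \<open>
  Two integrations by parts. Only the boundary at \<open>u = 1\<close> contributes, and the leading term is of
  order \<open>1 / v\<close>: this is why the integral over \<open>v\<close> converges only conditionally.
\<close>
lemma cutoff_transform_cosine:
  assumes y: "m \<le> y" and v: "v > 0" and b: "b > 0"
  shows "cutoff_transform (\<lambda>w. cos (b * w)) y v =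
    - (g y * sin (b * v) / (b * v)) - y * g' y * cos (b * v) / (b * v)\<^sup>2
    - integral {1..U} (\<lambda>u. y\<^sup>2 * g'' (u * y) * cos (b * (u * v))) / (b * v)\<^sup>2"
proof -
  define p where "p = b * v"
  have p: "p > 0" using v b by (simp add: p_def)
  (* The derivative of P is the integrand plus the remainder that appears in the claim. *)
  define P where "P u = g (u * y) * sin (p * u) / p + y * g' (u * y) * cos (p * u) / p\<^sup>2" for u
  have i: "(\<lambda>u. y\<^sup>2 * g'' (u * y) * cos (p * u)) integrable_on {1..U}"
    by (intro integrable_continuous_real continuous_intros continuous_on_compose2[OF g''_cont]) auto
  have "((\<lambda>u. g (u * y) * cos (p * u) + y\<^sup>2 * g'' (u * y) * cos (p * u) / p\<^sup>2)
      has_integral P U - P 1) {1..U}"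
  proof (rule fundamental_theorem_of_calculus)
    fix t
    have 1: "((\<lambda>u. g (u * y)) has_real_derivative g' (t * y) * y) (at t)"
      by (rule DERIV_chain2[OF g_deriv]) (auto intro!: derivative_eq_intros)
    have 2: "((\<lambda>u. g' (u * y)) has_real_derivative g'' (t * y) * y) (at t)"
      by (rule DERIV_chain2[OF g'_deriv]) (auto intro!: derivative_eq_intros)
    have "(P has_real_derivative g (t * y) * cos (p * t) + y\<^sup>2 * g'' (t * y) * cos (p * t) / p\<^sup>2) (at t)"
      unfolding P_def using p
      by (auto intro!: derivative_eq_intros 1 2 simp: field_simps power2_eq_square)
    then show "(P has_vector_derivative g (t * y) * cos (p * t) + y\<^sup>2 * g'' (t * y) * cos (p * t) / p\<^sup>2) (at t within {1..U})"
      by (simp add: has_real_derivative_iff_has_vector_derivative has_vector_derivative_at_within)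
  qed (use U_gt_1 in simp)
  from has_integral_diff[OF this has_integral_divide[OF integrable_integral[OF i], of "p\<^sup>2"]]
  have "((\<lambda>u. g (u * y) * cos (p * u)) has_integral
     P U - P 1 - integral {1..U} (\<lambda>u. y\<^sup>2 * g'' (u * y) * cos (p * u)) / p\<^sup>2) {1..U}"
    by simp
  then have "integral {1..U} (\<lambda>u. g (u * y) * cos (p * u)) =
     P U - P 1 - integral {1..U} (\<lambda>u. y\<^sup>2 * g'' (u * y) * cos (p * u)) / p\<^sup>2"
    by (rule integral_unique)
  moreover have "P U = 0" using Y_le_U_times[OF y] by (simp add: P_def g_zero g'_zero)
  ultimately show ?thesis
    by (simp add: cutoff_transform_def P_def p_def mult_ac)
qed

text \<open>
  Product formulas for \<open>cos (a v)\<close> times a sine or cosine reduce everything to the two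
  one-parameter families \<open>S\<close> and \<open>M\<close> of oscillatory integrals. In the last term the integral
  over \<open>v\<close> converges absolutely, and exchanging it with the integral over \<open>u\<close> exposes the
  frequencies \<open>b u \<plusminus> a\<close>, which makes decay in \<open>a\<close> accessible.
\<close>
lemma log_pairing_cosine:
  fixes a b x y T :: real
  assumes y: "m \<le> y" and x: "1 \<le> x" and b: "b > 0"
  defines "S \<equiv> \<lambda>c. integral {x..T} (\<lambda>v. ln v / v * sin (c * v))"
    and "M \<equiv> \<lambda>c. integral {x..T} (\<lambda>v. ln v / v\<^sup>2 * cos (c * v))"
  shows "log_pairing (\<lambda>w. cos (a * w)) (\<lambda>w. cos (b * w)) x T y =
    - (g y / (2 * b)) * (S (b + a) + S (b - a)) - y * g' y / (2 * b\<^sup>2) * (M (b + a) + M (b - a))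
    - integral {1..U} (\<lambda>u. y\<^sup>2 * g'' (u * y) * (M (b * u + a) + M (b * u - a))) / (2 * b\<^sup>2)"
proof -
  have pos: "v > 0" if "v \<in> {x..T}" for v using that x by auto
  define f where "f v u = ln v / v\<^sup>2 * cos (a * v) * (y\<^sup>2 * g'' (u * y) * cos (b * (u * v)))" for v u
  have fc: "continuous_on (cbox (x, 1) (T, U)) (\<lambda>(v, u). f v u)"
    unfolding f_def case_prod_unfold
    by (intro continuous_intros continuous_on_compose2[OF g''_cont])
       (use x in \<open>auto simp: cbox_Pair_eq\<close>)
  have fc': "continuous_on ({x..T} \<times> cbox 1 U) (\<lambda>(v, u). f v u)"
    using fc by (simp add: cbox_Pair_eq)
  have swap: "integral {x..T} (\<lambda>v. integral {1..U} (f v)) = integral {1..U} (\<lambda>u. integral {x..T} (\<lambda>v. f v u))"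
    using integral_swap_continuous[OF fc] by simp
  have S_int: "(\<lambda>v. ln v / v * sin (c * v)) integrable_on {x..T}" for c
    using x by (intro integrable_continuous_real continuous_intros) auto
  have M_int: "(\<lambda>v. ln v / v\<^sup>2 * cos (c * v)) integrable_on {x..T}" for c
    using x by (intro integrable_continuous_real continuous_intros) auto
  have S: "((\<lambda>v. ln v / v * sin (c * v)) has_integral S c) {x..T}" for c
    unfolding S_def by (rule integrable_integral[OF S_int])
  have M: "((\<lambda>v. ln v / v\<^sup>2 * cos (c * v)) has_integral M c) {x..T}" for c
    unfolding M_def by (rule integrable_integral[OF M_int])
  have I1: "((\<lambda>v. - (g y / (2 * b)) * (ln v / v * sin ((b + a) * v) + ln v / v * sin ((b - a) * v)))
     has_integral - (g y / (2 * b)) * (S (b + a) + S (b - a))) {x..T}"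
    by (intro has_integral_mult_right has_integral_add S)
  have I2: "((\<lambda>v. y * g' y / (2 * b\<^sup>2) * (ln v / v\<^sup>2 * cos ((b + a) * v) + ln v / v\<^sup>2 * cos ((b - a) * v)))
     has_integral y * g' y / (2 * b\<^sup>2) * (M (b + a) + M (b - a))) {x..T}"
    by (intro has_integral_mult_right has_integral_add M)
  have I3': "(\<lambda>v. integral {1..U} (f v)) integrable_on {x..T}"
    using integral_continuous_on_param[OF fc'] by (intro integrable_continuous_real) simp
  have "integral {x..T} (\<lambda>v. f v u) = y\<^sup>2 * g'' (u * y) * (M (b * u + a) + M (b * u - a)) / 2" for u
  proof -
    have "((\<lambda>v. y\<^sup>2 * g'' (u * y) / 2 * (ln v / v\<^sup>2 * cos ((b * u + a) * v) + ln v / v\<^sup>2 * cos ((b * u - a) * v)))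
     has_integral y\<^sup>2 * g'' (u * y) / 2 * (M (b * u + a) + M (b * u - a))) {x..T}"
      by (intro has_integral_mult_right has_integral_add M)
    moreover have "y\<^sup>2 * g'' (u * y) / 2 * (ln v / v\<^sup>2 * cos ((b * u + a) * v) + ln v / v\<^sup>2 * cos ((b * u - a) * v)) = f v u" for v
    proof -
      have e: "(b * u + a) * v = b * (u * v) + a * v" "(b * u - a) * v = b * (u * v) - a * v" for v
        by (auto simp: algebra_simps)
      show ?thesis
        by (simp add: e cos_add cos_diff f_def algebra_simps)
    qed
    ultimately have "((\<lambda>v. f v u) has_integral y\<^sup>2 * g'' (u * y) / 2 * (M (b * u + a) + M (b * u - a))) {x..T}"
      by simp
    then show ?thesis by (simp add: integral_unique)
  qed
  with swap have eq3: "integral {x..T} (\<lambda>v. integral {1..U} (f v)) =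
      integral {1..U} (\<lambda>u. y\<^sup>2 * g'' (u * y) * (M (b * u + a) + M (b * u - a))) / 2"
    by simp
  have alg: "- (G / (2 * b)) * (L / v * (sb * ca + cb * sa) + L / v * (sb * ca - cb * sa)) -
      y * H / (2 * b\<^sup>2) * (L / v\<^sup>2 * (cb * ca - sb * sa) + L / v\<^sup>2 * (cb * ca + sb * sa)) -
      L / v\<^sup>2 * ca * J / b\<^sup>2 =
      L * ca * (- (G * sb / (b * v)) - y * H * cb / (b * v)\<^sup>2 - J / (b * v)\<^sup>2)"
    if "v \<noteq> 0" "b \<noteq> 0" for G L v sb ca cb sa H J b y :: real
  proof -
    have 1: "r * (p + q) + r * (p - q) = 2 * (r * p)" "r * (p - q) + r * (p + q) = 2 * (r * p)"
      for p q r :: real by (auto simp: algebra_simps)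
    show ?thesis unfolding 1 using that
      by (simp add: right_diff_distrib power_mult_distrib mult_ac)
  qed
  have "((\<lambda>v. integral {1..U} (f v) / b\<^sup>2) has_integral
      integral {1..U} (\<lambda>u. y\<^sup>2 * g'' (u * y) * (M (b * u + a) + M (b * u - a))) / 2 / b\<^sup>2) {x..T}"
    using has_integral_divide[OF integrable_integral[OF I3']] unfolding eq3 .
  from has_integral_diff[OF has_integral_diff[OF I1 I2] this]
  have "((\<lambda>v. ln v * cos (a * v) * cutoff_transform (\<lambda>w. cos (b * w)) y v) has_integral
     - (g y / (2 * b)) * (S (b + a) + S (b - a)) - y * g' y / (2 * b\<^sup>2) * (M (b + a) + M (b - a))
     - integral {1..U} (\<lambda>u. y\<^sup>2 * g'' (u * y) * (M (b * u + a) + M (b * u - a))) / 2 / b\<^sup>2) {x..T}"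
  proof (rule has_integral_eq[rotated])
    fix v assume "v \<in> {x..T}"
    then have v: "v > 0" by (rule pos)
    have f: "integral {1..U} (f v) = ln v / v\<^sup>2 * cos (a * v) *
        integral {1..U} (\<lambda>u. y\<^sup>2 * g'' (u * y) * cos (b * (u * v)))"
      unfolding f_def by (rule integral_mult_right)
    show "- (g y / (2 * b)) * (ln v / v * sin ((b + a) * v) + ln v / v * sin ((b - a) * v)) -
         y * g' y / (2 * b\<^sup>2) * (ln v / v\<^sup>2 * cos ((b + a) * v) + ln v / v\<^sup>2 * cos ((b - a) * v)) -
         integral {1..U} (f v) / b\<^sup>2 =
         ln v * cos (a * v) * cutoff_transform (\<lambda>w. cos (b * w)) y v"
      unfolding f cutoff_transform_cosine[OF y v b] distrib_right left_diff_distrib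
        sin_add sin_diff cos_add cos_diff
      by (rule alg) (use v b in auto)
  qed
  then show ?thesis by (simp add: log_pairing_def integral_unique)
qed

lemma log_pairing_cosine_bound_aux:
  assumes y: "m \<le> y" and x: "1 \<le> x" and b: "b > 0"
    and B: "\<bar>g y\<bar> \<le> B" "\<bar>y * g' y\<bar> \<le> B" "\<And>u. u \<in> {1..U} \<Longrightarrow> \<bar>y\<^sup>2 * g'' (u * y)\<bar> \<le> B"
    and S: "\<And>c. c \<in> {b + a, b - a} \<Longrightarrow> \<bar>integral {x..T} (\<lambda>v. ln v / v * sin (c * v))\<bar> \<le> K"
    and M: "\<And>c u. u \<in> {1..U} \<Longrightarrow> c \<in> {b * u + a, b * u - a} \<Longrightarrow>
        \<bar>integral {x..T} (\<lambda>v. ln v / v\<^sup>2 * cos (c * v))\<bar> \<le> K"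
  shows "\<bar>log_pairing (\<lambda>w. cos (a * w)) (\<lambda>w. cos (b * w)) x T y\<bar> \<le> B * K / b * (1 + U / b)"
proof -
  define S M where "S c = integral {x..T} (\<lambda>v. ln v / v * sin (c * v))"
    and "M c = integral {x..T} (\<lambda>v. ln v / v\<^sup>2 * cos (c * v))" for c
  have S': "\<bar>S (b + a) + S (b - a)\<bar> \<le> 2 * K"
    using S[of "b + a"] S[of "b - a"] by (auto simp: S_def abs_le_iff)
  have M': "\<bar>M (b * u + a) + M (b * u - a)\<bar> \<le> 2 * K" if "u \<in> {1..U}" for u
    using M[OF that, of "b * u + a"] M[OF that, of "b * u - a"] by (simp add: M_def abs_le_iff)
  have M1: "\<bar>M (b + a) + M (b - a)\<bar> \<le> 2 * K" using M'[of 1] U_gt_1 by simp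
  have B0: "0 \<le> B" using B(1) by linarith
  define J where "J = integral {1..U} (\<lambda>u. y\<^sup>2 * g'' (u * y) * (M (b * u + a) + M (b * u - a)))"
  have "norm J \<le> B * (2 * K) * (U - 1)"
    unfolding J_def
  proof (rule integral_bound)
    have "continuous_on ({1..U} \<times> cbox x T) (\<lambda>(u, v). ln v / v\<^sup>2 * cos ((b * u + s * a) * v))" for s
      unfolding case_prod_unfold using x by (intro continuous_intros) auto
    from integral_continuous_on_param[OF this]
    have "continuous_on {1..U} (\<lambda>u. M (b * u + s * a))" for s by (simp add: M_def)
    from this[of 1] this[of "-1"]
    have "continuous_on {1..U} (\<lambda>u. M (b * u + a))" "continuous_on {1..U} (\<lambda>u. M (b * u - a))"
      by simp_all
    then show "continuous_on {1..U} (\<lambda>u. y\<^sup>2 * g'' (u * y) * (M (b * u + a) + M (b * u - a)))"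
      by (intro continuous_intros continuous_on_compose2[OF g''_cont]) auto
    show "norm (y\<^sup>2 * g'' (u * y) * (M (b * u + a) + M (b * u - a))) \<le> B * (2 * K)"
      if "u \<in> {1..U}" for u
      unfolding real_norm_def abs_mult[of "y\<^sup>2 * g'' (u * y)"]
      using B0 by (intro mult_mono M' that B) auto
  qed (use U_gt_1 in simp)
  then have J: "\<bar>J\<bar> \<le> B * (2 * K) * (U - 1)" by simp
  have "\<bar>log_pairing (\<lambda>w. cos (a * w)) (\<lambda>w. cos (b * w)) x T y\<bar> =
      \<bar>g y * (S (b + a) + S (b - a)) / (2 * b) + y * g' y * (M (b + a) + M (b - a)) / (2 * b\<^sup>2) + J / (2 * b\<^sup>2)\<bar>"
    unfolding log_pairing_cosine[OF y x b] J_def S_def M_def abs_minus_cancel[symmetric, of "_ - _"]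
    by (rule arg_cong[where f = abs]) simp
  also have "\<dots> \<le> \<bar>g y * (S (b + a) + S (b - a))\<bar> / (2 * b)
      + \<bar>y * g' y * (M (b + a) + M (b - a))\<bar> / (2 * b\<^sup>2) + \<bar>J\<bar> / (2 * b\<^sup>2)"
  proof -
    have tri: "\<bar>p / r + q / s + t / s\<bar> \<le> \<bar>p\<bar> / r + \<bar>q\<bar> / s + \<bar>t\<bar> / s" if "r > 0" "s > 0" for p q r s t :: real
    proof -
      have "\<bar>p / r + q / s + t / s\<bar> \<le> \<bar>p / r\<bar> + \<bar>q / s\<bar> + \<bar>t / s\<bar>" by linarith
      then show ?thesis using that by simp
    qed
    show ?thesis using b by (intro tri) auto
  qed
  also have "\<dots> \<le> B * (2 * K) / (2 * b) + B * (2 * K) / (2 * b\<^sup>2) + B * (2 * K) * (U - 1) / (2 * b\<^sup>2)"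
    unfolding abs_mult[of "g y"] abs_mult[of "y * g' y"]
    using b B0 by (intro add_mono divide_right_mono mult_mono S' M1 B J) auto
  also have "\<dots> = B * K / b * (1 + U / b)"
    using b by (simp add: field_simps power2_eq_square)
  finally show ?thesis .
qed

text \<open>
  A bound by \<open>1 / b\<close> alone would not be summable over both frequencies, so decay in \<open>a\<close> is
  needed too. If \<open>a \<le> 2 U b\<close>, then \<open>1 / b\<close> is already of the size of \<open>1 / sqrt (a b)\<close>. If \<open>a\<close> is
  larger, then all frequencies \<open>b u \<plusminus> a\<close> with \<open>1 \<le> u \<le> U\<close> have modulus at least \<open>a / 2\<close>, so no
  resonance occurs and oscillation gains a factor \<open>1 / a\<close>.
\<close>
lemma log_pairing_cosine_bound:
  assumes y: "m \<le> y" and x: "1 \<le> x" "x \<le> T"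
    and B: "\<bar>g y\<bar> \<le> B" "\<bar>y * g' y\<bar> \<le> B" "\<And>u. u \<in> {1..U} \<Longrightarrow> \<bar>y\<^sup>2 * g'' (u * y)\<bar> \<le> B"
    and d: "0 < d" "d \<le> 1" "d \<le> a" "d \<le> b" "a = b \<or> d \<le> \<bar>a - b\<bar>"
  shows "\<bar>log_pairing (\<lambda>w. cos (a * w)) (\<lambda>w. cos (b * w)) x T y\<bar>
     \<le> 12 * B * U * (1 + U / d) / d * tail_bound x / sqrt (a * b)"
proof -
  let ?P = "\<bar>log_pairing (\<lambda>w. cos (a * w)) (\<lambda>w. cos (b * w)) x T y\<bar>"
  let ?E = "tail_bound x"
  have E: "0 < ?E" using x tail_bound_pos by simp
  have ab: "0 < a" "0 < b" using d by auto
  have U: "1 < U" by (rule U_gt_1)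
  have B0: "0 \<le> B" using B(1) by linarith
  have ub: "1 + U / b \<le> 1 + U / d" using d ab U by (intro add_mono divide_left_mono) auto
  show ?thesis
  proof (cases "a \<le> 2 * U * b")
    case True
    have b1: "?P \<le> B * (6 * ?E * (1 / d)) / b * (1 + U / b)"
    proof (rule log_pairing_cosine_bound_aux[OF y x(1) ab(2) B])
      fix c assume c: "c \<in> {b + a, b - a}"
      show "\<bar>integral {x..T} (\<lambda>v. ln v / v * sin (c * v))\<bar> \<le> 6 * ?E * (1 / d)"
      proof (cases "c = 0")
        case False
        with c d ab have "d \<le> \<bar>c\<bar>" by auto
        then have "6 * ?E * (1 / \<bar>c\<bar>) \<le> 6 * ?E * (1 / d)"
          using E d False by (intro mult_left_mono divide_left_mono) auto
        with log_sine_integral_bound[OF x, of c] show ?thesis by linarith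
      qed (use E d in auto)
    next
      fix c u
      have "?E * 1 \<le> 6 * ?E * (1 / d)" using E d by (intro mult_mono) auto
      with log_cosine_integral_trivial_bound[OF x, of c]
      show "\<bar>integral {x..T} (\<lambda>v. ln v / v\<^sup>2 * cos (c * v))\<bar> \<le> 6 * ?E * (1 / d)" by linarith
    qed
    have "sqrt (a * b) \<le> sqrt ((2 * U * b)\<^sup>2)"
    proof (rule real_sqrt_le_mono)
      have "a * b \<le> (2 * U * b) * (2 * U * b)"
        using True ab U by (intro mult_mono) auto
      then show "a * b \<le> (2 * U * b)\<^sup>2" by (simp add: power2_eq_square)
    qed
    then have "sqrt (a * b) \<le> 2 * U * b" using ab U by simp
    then have b2: "1 / b \<le> 2 * U / sqrt (a * b)" using ab U by (simp add: field_simps)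
    have "B * (6 * ?E * (1 / d)) / b * (1 + U / b) = B * (6 * ?E * (1 / d)) * (1 / b) * (1 + U / b)" by simp
    also have "\<dots> \<le> B * (6 * ?E * (1 / d)) * (2 * U / sqrt (a * b)) * (1 + U / d)"
      using B0 E d ab U by (intro mult_mono b2 ub order_refl) auto
    also have "\<dots> = 12 * B * U * (1 + U / d) / d * tail_bound x / sqrt (a * b)"
      by (simp add: field_simps)
    finally show ?thesis using b1 by linarith
  next
    case False
    have far: "\<bar>c\<bar> \<ge> a / 2" "c \<noteq> 0" if "u \<in> {1..U}" "c \<in> {b * u + a, b * u - a}" for u c
    proof -
      have bu: "b * u \<le> b * U" "b * u > 0" using that ab by auto
      moreover have "2 * (b * U) < a" using False by (simp add: algebra_simps not_le)
      moreover have "c = b * u + a \<or> c = b * u - a" using that(2) by auto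
      ultimately show "\<bar>c\<bar> \<ge> a / 2" using bu ab by linarith
      with ab show "c \<noteq> 0" by auto
    qed
    have le: "6 * ?E * (1 / \<bar>c\<bar>) \<le> 6 * ?E * (2 / a)" if "\<bar>c\<bar> \<ge> a / 2" for c
    proof -
      have "1 / \<bar>c\<bar> \<le> 1 / (a / 2)" using that ab by (intro divide_left_mono) auto
      then show ?thesis using E by (intro mult_left_mono) auto
    qed
    have b1: "?P \<le> B * (6 * ?E * (2 / a)) / b * (1 + U / b)"
    proof (rule log_pairing_cosine_bound_aux[OF y x(1) ab(2) B])
      fix c assume c: "c \<in> {b + a, b - a}"
      have "\<bar>c\<bar> \<ge> a / 2" using far[of 1 c] c U by simp
      from le[OF this] log_sine_integral_bound[OF x, of c]
      show "\<bar>integral {x..T} (\<lambda>v. ln v / v * sin (c * v))\<bar> \<le> 6 * ?E * (2 / a)" by linarith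
    next
      fix c u assume "u \<in> {1..U}" "c \<in> {b * u + a, b * u - a}"
      from le[OF far(1)[OF this]] log_cosine_integral_bound[OF x far(2)[OF this]]
      show "\<bar>integral {x..T} (\<lambda>v. ln v / v\<^sup>2 * cos (c * v))\<bar> \<le> 6 * ?E * (2 / a)" by linarith
    qed
    have "d = sqrt (d * d)" using d by simp
    also have "\<dots> \<le> sqrt (a * b)" using d by (intro real_sqrt_le_mono mult_mono) auto
    finally have "d \<le> sqrt (a * b)" .
    have "1 / (a * b) = (1 / sqrt (a * b)) * (1 / sqrt (a * b))"
      using ab by simp
    also have "\<dots> \<le> (U / d) * (1 / sqrt (a * b))"
      using \<open>d \<le> sqrt (a * b)\<close> d ab U by (intro mult_right_mono frac_le) auto
    finally have b2: "1 / (a * b) \<le> (U / d) * (1 / sqrt (a * b))" .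
    have "B * (6 * ?E * (2 / a)) / b * (1 + U / b) = 12 * B * ?E * (1 / (a * b)) * (1 + U / b)"
      by (simp add: field_simps)
    also have "\<dots> \<le> 12 * B * ?E * ((U / d) * (1 / sqrt (a * b))) * (1 + U / d)"
      using B0 E d ab U by (intro mult_mono b2 ub order_refl) auto
    also have "\<dots> = 12 * B * U * (1 + U / d) / d * tail_bound x / sqrt (a * b)"
      by (simp add: field_simps)
    finally show ?thesis using b1 by linarith
  qed
qed

end

section \<open>Positivity\<close>

context smooth_bump begin

definition autocorr :: "real \<Rightarrow> real" where
  "autocorr u = integral {m..Y} (\<lambda>y. g (u * y) * g y)"

text \<open>
  The truncated integral over \<open>v\<close> in the theorem, with arbitrary kernels in place of the cosines.
\<close>
definition log_form :: "(real \<Rightarrow> real) \<Rightarrow> (real \<Rightarrow> real) \<Rightarrow> real \<Rightarrow> real" where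
  "log_form \<Phi> \<Psi> T = integral {1..T} (\<lambda>v. ln v * \<Phi> v * integral {1..U} (\<lambda>u. autocorr u * \<Psi> (u * v)))"

lemma cutoff_transform_cont:
  assumes "continuous_on UNIV \<Psi>"
  shows "continuous_on UNIV (\<lambda>(y, v). cutoff_transform \<Psi> y v)"
proof -
  have "continuous_on (UNIV \<times> cbox 1 U) (\<lambda>(p, u). g (u * fst p) * \<Psi> (u * snd p))"
    unfolding case_prod_unfold
    by (intro continuous_intros continuous_on_compose2[OF g_cont] continuous_on_compose2[OF assms]) auto
  from integral_continuous_on_param[OF this] show ?thesis
    by (simp add: cutoff_transform_def case_prod_unfold)
qed

lemma cutoff_transform_cont_compose [continuous_intros]:
  assumes "continuous_on UNIV \<Psi>" "continuous_on A p" "continuous_on A q"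
  shows "continuous_on A (\<lambda>z. cutoff_transform \<Psi> (p z) (q z))"
  using continuous_on_compose2[OF cutoff_transform_cont[OF assms(1)] continuous_on_Pair[OF assms(2,3)]]
  by simp

lemma g_cont_compose [continuous_intros]:
  "continuous_on A p \<Longrightarrow> continuous_on A (\<lambda>z. g (p z))"
  by (rule continuous_on_compose2[OF g_cont]) auto

text \<open>
  The autocorrelation is a superposition of the dilates \<open>u \<mapsto> g (u * y)\<close> with weight \<open>g y\<close>; all
  integrals run over compact boxes and have continuous integrands, so they can be exchanged.
\<close>
lemma has_integral_log_form:
  assumes \<Phi>: "continuous_on UNIV \<Phi>" and \<Psi>: "continuous_on UNIV \<Psi>"
  shows "((\<lambda>y. g y * log_pairing \<Phi> \<Psi> 1 T y) has_integral log_form \<Phi> \<Psi> T) {m..Y}"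
proof -
  note [continuous_intros] = continuous_on_compose2[OF \<Phi>] continuous_on_compose2[OF \<Psi>]
  have 1: "integral {1..U} (\<lambda>u. autocorr u * \<Psi> (u * v)) = integral {m..Y} (\<lambda>y. g y * cutoff_transform \<Psi> y v)" for v
  proof -
    have "integral {1..U} (\<lambda>u. autocorr u * \<Psi> (u * v)) =
        integral (cbox 1 U) (\<lambda>u. integral (cbox m Y) (\<lambda>y. g (u * y) * g y * \<Psi> (u * v)))"
      by (simp add: autocorr_def)
    also have "\<dots> = integral (cbox m Y) (\<lambda>y. integral (cbox 1 U) (\<lambda>u. g (u * y) * g y * \<Psi> (u * v)))"
      by (rule integral_swap_continuous) (auto simp: case_prod_unfold intro!: continuous_intros)
    also have "\<dots> = integral {m..Y} (\<lambda>y. g y * cutoff_transform \<Psi> y v)"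
      by (simp add: cutoff_transform_def mult_ac flip: integral_mult_right)
    finally show ?thesis .
  qed
  define k where "k v y = ln v * \<Phi> v * (g y * cutoff_transform \<Psi> y v)" for v y
  have kc: "continuous_on (cbox (1, m) (T, Y)) (\<lambda>(v, y). k v y)"
    unfolding k_def case_prod_unfold
    by (intro continuous_intros \<Psi>) (auto simp: cbox_Pair_eq)
  have "log_form \<Phi> \<Psi> T = integral (cbox 1 T) (\<lambda>v. integral (cbox m Y) (k v))"
    by (simp add: log_form_def 1 k_def[abs_def])
  also have "\<dots> = integral (cbox m Y) (\<lambda>y. integral (cbox 1 T) (\<lambda>v. k v y))"
    by (rule integral_swap_continuous[OF kc])
  also have "\<dots> = integral {m..Y} (\<lambda>y. g y * log_pairing \<Phi> \<Psi> 1 T y)"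
    by (simp add: k_def log_pairing_def mult_ac flip: integral_mult_right)
  finally have eq: "log_form \<Phi> \<Psi> T = integral {m..Y} (\<lambda>y. g y * log_pairing \<Phi> \<Psi> 1 T y)" .
  have "continuous_on ({m..Y} \<times> cbox 1 T) (\<lambda>(y, v). ln v * \<Phi> v * cutoff_transform \<Psi> y v)"
    unfolding case_prod_unfold by (intro continuous_intros \<Psi>) auto
  from integral_continuous_on_param[OF this]
  have "continuous_on {m..Y} (\<lambda>y. g y * log_pairing \<Phi> \<Psi> 1 T y)"
    unfolding log_pairing_def by (intro continuous_intros) auto
  then show ?thesis unfolding eq by (intro integrable_integral integrable_continuous_real)
qed

text \<open>
  The source of positivity. With \<open>H y\<close> the integral of \<open>G\<close> over \<open>[y, Y]\<close> the integrand is
  \<open>- (H\<^sup>2)' / 2\<close> times the nondecreasing function \<open>ln\<^sup>+ (s y)\<close>, and \<open>H\<close> vanishes at \<open>Y\<close>.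
\<close>
lemma log_kernel_nonneg:
  assumes G: "continuous_on {m..Y} G" and s: "s > 0"
  shows "0 \<le> integral {m..Y} (\<lambda>y. G y * ln (max 1 (s * y)) * integral {y..Y} G)"
proof -
  define H where "H y = integral {y..Y} G" for y
  have dH: "(H has_real_derivative - G t) (at t within {m..Y})" if "t \<in> {m..Y}" for t
    unfolding H_def by (rule integral_has_real_derivative'[OF G that])
  have Hc: "continuous_on {m..Y} H"
    by (rule DERIV_continuous_on[OF dH])
  have ln0: "ln (max 1 (s * y)) = 0" if "s * y \<le> 1" for y
    using that by simp
  let ?f = "\<lambda>y. G y * ln (max 1 (s * y)) * H y"
  have eq: "integral {m..Y} (\<lambda>y. G y * ln (max 1 (s * y)) * integral {y..Y} G) = integral {m..Y} ?f"
    by (simp add: H_def)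
  have fi: "?f integrable_on {m..Y}"
    by (intro integrable_continuous_real continuous_intros G Hc) auto
  show ?thesis
  proof (cases "s * Y \<le> 1")
    case True
    have "integral {m..Y} ?f = integral {m..Y} (\<lambda>y. 0)"
    proof (rule integral_cong)
      fix y assume y: "y \<in> {m..Y}"
      have "s * y \<le> s * Y" using y s by (intro mult_left_mono) auto
      with True ln0[of y] show "?f y = 0" by simp
    qed
    then show ?thesis unfolding eq by simp
  next
    case False
    (* Below c the logarithmic factor vanishes; at c the boundary term has the right sign,
       also when c = m > 1 / s. *)
    define c where "c = max m (1 / s)"
    have c: "m \<le> c" "c \<le> Y" "s * c \<ge> 1" "0 < c"
      using False s m_less m_pos by (auto simp: c_def field_simps max_def)
    have z: "integral {m..c} ?f = 0"
    proof (cases "c = m")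
      case False
      have "integral {m..c} ?f = integral {m..c} (\<lambda>y. 0)"
      proof (rule integral_cong)
        fix y assume y: "y \<in> {m..c}"
        have "c = 1 / s" using False by (auto simp: c_def max_def split: if_splits)
        with y s have "s * y \<le> 1" by (simp add: field_simps)
        then show "?f y = 0" by (simp add: ln0)
      qed
      then show ?thesis by simp
    qed simp
    define K where "K y = - (H y)\<^sup>2 * ln (s * y) / 2" for y
    have "((\<lambda>y. G y * ln (s * y) * H y - (H y)\<^sup>2 / y / 2) has_integral K Y - K c) {c..Y}"
    proof (rule fundamental_theorem_of_calculus[OF c(2)])
      fix t assume t: "t \<in> {c..Y}"
      with c have t': "t \<in> {m..Y}" "t > 0" by auto
      have d: "(H has_real_derivative - G t) (at t within {c..Y})"
        by (rule DERIV_subset[OF dH[OF t'(1)]]) (use c in auto)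
      have "(K has_real_derivative G t * ln (s * t) * H t - (H t)\<^sup>2 / t / 2) (at t within {c..Y})"
        unfolding K_def using t' s
        by (auto intro!: derivative_eq_intros d simp: field_simps power2_eq_square)
      then show "(K has_vector_derivative G t * ln (s * t) * H t - (H t)\<^sup>2 / t / 2) (at t within {c..Y})"
        by (simp add: has_real_derivative_iff_has_vector_derivative)
    qed
    moreover have i2: "(\<lambda>y. (H y)\<^sup>2 / y / 2) integrable_on {c..Y}"
      using c by (intro integrable_continuous_real continuous_intros continuous_on_subset[OF Hc]) auto
    ultimately have "((\<lambda>y. G y * ln (s * y) * H y - (H y)\<^sup>2 / y / 2 + (H y)\<^sup>2 / y / 2) has_integral
        K Y - K c + integral {c..Y} (\<lambda>y. (H y)\<^sup>2 / y / 2)) {c..Y}"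
      by (intro has_integral_add integrable_integral)
    then have "((\<lambda>y. G y * ln (s * y) * H y) has_integral
        K Y - K c + integral {c..Y} (\<lambda>y. (H y)\<^sup>2 / y / 2)) {c..Y}"
      by simp
    then have "(?f has_integral K Y - K c + integral {c..Y} (\<lambda>y. (H y)\<^sup>2 / y / 2)) {c..Y}"
    proof (rule has_integral_eq[rotated])
      fix y assume y: "y \<in> {c..Y}"
      have "s * c \<le> s * y" using y s by (intro mult_left_mono) auto
      with c show "G y * ln (s * y) * H y = ?f y" by (simp add: max_def)
    qed
    then have "integral {c..Y} ?f = K Y - K c + integral {c..Y} (\<lambda>y. (H y)\<^sup>2 / y / 2)"
      by (rule integral_unique)
    moreover have "K Y = 0" by (simp add: K_def H_def)
    moreover have "K c \<le> 0" using c by (simp add: K_def)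
    moreover have "0 \<le> integral {c..Y} (\<lambda>y. (H y)\<^sup>2 / y / 2)"
      using c by (intro integral_nonneg i2) auto
    ultimately have "0 \<le> integral {c..Y} ?f" by linarith
    then show ?thesis
      unfolding eq using Henstock_Kurzweil_Integration.integral_combine[of m c Y ?f] c fi z by simp
  qed
qed

text \<open>
  The substitution \<open>t = u * y\<close>; it turns the transform at \<open>v = s * y\<close> into the function \<open>H\<close> for
  \<open>G t = g t * \<Psi> (s * t)\<close> in the preceding argument.
\<close>
lemma cutoff_transform_eq_tail_integral:
  assumes \<Psi>: "continuous_on UNIV \<Psi>" and y: "m \<le> y" "y \<le> Y"
  shows "y * cutoff_transform \<Psi> y (s * y) = integral {y..Y} (\<lambda>t. g t * \<Psi> (s * t))"
proof -
  note [continuous_intros] = continuous_on_compose2[OF \<Psi>]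
  let ?G = "\<lambda>t. g t * \<Psi> (s * t)"
  have y0: "y > 0" using y m_pos by simp
  have Gc: "continuous_on A ?G" for A by (intro continuous_intros) auto
  have "((\<lambda>u. y *\<^sub>R ?G (u * y)) has_integral (integral {1 * y..U * y} ?G)) {1..U}"
  proof (rule has_integral_substitution)
    show "(\<lambda>u. u * y) ` {1..U} \<subseteq> {y..U * y}" using y0 by auto
    show "1 * y \<le> U * y" using y0 U_gt_1 by simp
    fix u
    show "((\<lambda>u. u * y) has_real_derivative y) (at u within {1..U})"
      by (auto intro!: derivative_eq_intros)
  qed (use U_gt_1 Gc in auto)
  from integral_unique[OF this]
  have "integral {1..U} (\<lambda>u. y * ?G (u * y)) = integral {y..U * y} ?G" by simp
  moreover have "integral {1..U} (\<lambda>u. y * ?G (u * y)) = y * cutoff_transform \<Psi> y (s * y)"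
    unfolding integral_mult_right cutoff_transform_def by (simp add: mult_ac)
  moreover have "integral {y..U * y} ?G = integral {y..Y} ?G + integral {Y..U * y} ?G"
    using y Y_le_U_times[of y]
    by (intro Henstock_Kurzweil_Integration.integral_combine[symmetric] integrable_continuous_real Gc) auto
  moreover have "integral {Y..U * y} ?G = integral {Y..U * y} (\<lambda>_. 0)"
    by (rule integral_cong) (simp add: g_zero)
  ultimately show ?thesis by simp
qed

text \<open>
  The integral over \<open>0 \<le> s \<le> M\<close> of the nonnegative quantities of \<open>log_kernel_nonneg\<close>. The
  substitution \<open>v = s * y\<close> produces the cutoff \<open>M * y\<close>, which depends on \<open>y\<close>; the condition on
  \<open>M\<close> ensures that it is at least \<open>1\<close>.
\<close>
lemma dilated_log_form_nonneg:
  assumes \<Phi>: "continuous_on UNIV \<Phi>" and M: "1 / m \<le> M"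
  shows "(\<lambda>y. g y * log_pairing \<Phi> \<Phi> 1 (M * y) y) integrable_on {m..Y}"
    and "0 \<le> integral {m..Y} (\<lambda>y. g y * log_pairing \<Phi> \<Phi> 1 (M * y) y)"
proof -
  note [continuous_intros] = continuous_on_compose2[OF \<Phi>]
  define k where "k y v = ln (max 1 v) * \<Phi> v * cutoff_transform \<Phi> y v" for y v
  have kc: "continuous_on A (k y)" for A y
    unfolding k_def by (intro continuous_intros \<Phi>) auto
  have log_pairing: "g y * log_pairing \<Phi> \<Phi> 1 (M * y) y = integral (cbox 0 M) (\<lambda>s. g y * (y * k y (s * y)))"
    if y: "y \<in> {m..Y}" for y
  proof -
    have y0: "y > 0" using y m_pos by auto
    have "0 < 1 / m" using m_pos by simp
    with M have M0: "M > 0" by linarith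
    have "1 = 1 / m * m" using m_pos by simp
    also have "\<dots> \<le> M * y" using y m_pos M M0 by (intro mult_mono) auto
    finally have My: "1 \<le> M * y" .
    have "((\<lambda>s. y *\<^sub>R k y (s * y)) has_integral (integral {0 * y..M * y} (k y))) {0..M}"
    proof (rule has_integral_substitution)
      show "(\<lambda>u. u * y) ` {0..M} \<subseteq> {0..M * y}" using y0 by auto
      fix u
      show "((\<lambda>u. u * y) has_real_derivative y) (at u within {0..M})"
        by (auto intro!: derivative_eq_intros)
    qed (use M0 y0 kc in auto)
    from integral_unique[OF this]
    have "integral {0..M} (\<lambda>s. y * k y (s * y)) = integral {0..M * y} (k y)" by simp
    also have "\<dots> = integral {0..1} (k y) + integral {1..M * y} (k y)"
      using My by (intro Henstock_Kurzweil_Integration.integral_combine[symmetric] integrable_continuous_real kc) auto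
    also have "integral {0..1} (k y) = integral {0..1} (\<lambda>_::real. 0::real)"
      by (rule Henstock_Kurzweil_Integration.integral_cong) (simp add: k_def max_def)
    also have "integral {1..M * y} (k y) = log_pairing \<Phi> \<Phi> 1 (M * y) y"
      unfolding log_pairing_def by (rule integral_cong) (simp add: k_def max_def)
    finally show ?thesis by simp
  qed
  have c: "continuous_on (cbox (0, m) (M, Y)) (\<lambda>(s, y). g y * (y * k y (s * y)))"
    unfolding k_def case_prod_unfold by (intro continuous_intros \<Phi>) auto
  have c': "continuous_on ({m..Y} \<times> cbox 0 M) (\<lambda>(y, s). g y * (y * k y (s * y)))"
    unfolding k_def case_prod_unfold by (intro continuous_intros \<Phi>) auto
  have "(\<lambda>y. integral (cbox 0 M) (\<lambda>s. g y * (y * k y (s * y)))) integrable_on {m..Y}"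
    by (intro integrable_continuous_real integral_continuous_on_param c')
  then show "(\<lambda>y. g y * log_pairing \<Phi> \<Phi> 1 (M * y) y) integrable_on {m..Y}"
    by (rule integrable_eq) (simp only: log_pairing)
  have "integral {m..Y} (\<lambda>y. g y * log_pairing \<Phi> \<Phi> 1 (M * y) y) =
     integral (cbox m Y) (\<lambda>y. integral (cbox 0 M) (\<lambda>s. g y * (y * k y (s * y))))"
    unfolding cbox_interval by (rule integral_cong) (simp add: log_pairing)
  also have "\<dots> = integral (cbox 0 M) (\<lambda>s. integral (cbox m Y) (\<lambda>y. g y * (y * k y (s * y))))"
    by (rule integral_swap_continuous[OF c, symmetric])
  also have "\<dots> \<ge> 0"
  proof (rule integral_nonneg)
    have "continuous_on ({0..M} \<times> cbox m Y) (\<lambda>(s, y). g y * (y * k y (s * y)))"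
      using c by (simp add: cbox_Pair_eq)
    from integral_continuous_on_param[OF this]
    show "(\<lambda>s. integral (cbox m Y) (\<lambda>y. g y * (y * k y (s * y)))) integrable_on cbox 0 M"
      by (simp add: integrable_continuous_real)
    fix s assume s: "s \<in> cbox 0 M"
    let ?G = "\<lambda>y. g y * \<Phi> (s * y)"
    have "integral (cbox m Y) (\<lambda>y. g y * (y * k y (s * y))) =
        integral {m..Y} (\<lambda>y. ?G y * ln (max 1 (s * y)) * integral {y..Y} ?G)"
      unfolding cbox_interval
    proof (rule integral_cong)
      fix y assume "y \<in> {m..Y}"
      then have "y * cutoff_transform \<Phi> y (s * y) = integral {y..Y} ?G"
        by (intro cutoff_transform_eq_tail_integral \<Phi>) auto
      then show "g y * (y * k y (s * y)) = ?G y * ln (max 1 (s * y)) * integral {y..Y} ?G"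
        by (simp add: k_def mult_ac flip: \<open>_ = integral {y..Y} ?G\<close>)
    qed
    also have "\<dots> \<ge> 0"
    proof (cases "s = 0")
      case False
      then show ?thesis using s by (intro log_kernel_nonneg continuous_intros) auto
    qed simp
    finally show "0 \<le> integral (cbox m Y) (\<lambda>y. g y * (y * k y (s * y)))" .
  qed
  finally show "0 \<le> integral {m..Y} (\<lambda>y. g y * log_pairing \<Phi> \<Phi> 1 (M * y) y)" .
qed

lemma log_pairing_combine:
  assumes \<Phi>: "continuous_on UNIV \<Phi>" and \<Psi>: "continuous_on UNIV \<Psi>" and "1 \<le> T" "T \<le> T'"
  shows "log_pairing \<Phi> \<Psi> 1 T' y = log_pairing \<Phi> \<Psi> 1 T y + log_pairing \<Phi> \<Psi> T T' y"
  unfolding log_pairing_def using assms(3,4)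
  by (intro Henstock_Kurzweil_Integration.integral_combine[symmetric] integrable_continuous_real continuous_intros \<Psi>
      continuous_on_compose2[OF \<Phi>]) auto

text \<open>
  With \<open>M = T / m\<close> the cutoff \<open>M * y\<close> is at least \<open>T\<close> for all \<open>y \<ge> m\<close>, so that replacing it by
  \<open>T\<close> changes the pairing by a tail, which is uniformly small.
\<close>
lemma log_form_limit_nonneg:
  assumes \<Phi>: "continuous_on UNIV \<Phi>"
    and K: "\<And>x T y. 1 \<le> x \<Longrightarrow> x \<le> T \<Longrightarrow> y \<in> {m..Y} \<Longrightarrow> \<bar>log_pairing \<Phi> \<Phi> x T y\<bar> \<le> K * tail_bound x"
    and B: "\<And>y. y \<in> {m..Y} \<Longrightarrow> \<bar>g y\<bar> \<le> B"
    and L: "(log_form \<Phi> \<Phi> \<longlongrightarrow> L) at_top"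
  shows "0 \<le> L"
proof -
  have lower: "- (B * (K * tail_bound T) * (Y - m)) \<le> log_form \<Phi> \<Phi> T" if T: "1 \<le> T" for T
  proof -
    define M where "M = T / m"
    have M: "1 / m \<le> M" using T m_pos by (simp add: M_def divide_right_mono)
    note d = dilated_log_form_nonneg[OF \<Phi> M]
    note hi = has_integral_diff[OF integrable_integral[OF d(1)] has_integral_log_form[OF \<Phi> \<Phi>, of T]]
    have "norm (integral {m..Y} (\<lambda>y. g y * log_pairing \<Phi> \<Phi> 1 (M * y) y) - log_form \<Phi> \<Phi> T)
        \<le> B * (K * tail_bound T) * measure lborel {m..Y}"
    proof (rule has_integral_bound_real[OF _ finite.emptyI hi])
      show "0 \<le> B * (K * tail_bound T)"
      proof (rule mult_nonneg_nonneg)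
        show "0 \<le> B" using B[of m] m_less by simp
        show "0 \<le> K * tail_bound T" using K[of T T m] T m_less by simp
      qed
      fix y assume "y \<in> {m..Y} - {}"
      then have y: "y \<in> {m..Y}" by simp
      have "T * m \<le> T * y" using y T by (intro mult_left_mono) auto
      then have My: "T \<le> M * y" using m_pos by (simp add: M_def field_simps)
      have "g y * log_pairing \<Phi> \<Phi> 1 (M * y) y - g y * log_pairing \<Phi> \<Phi> 1 T y = g y * log_pairing \<Phi> \<Phi> T (M * y) y"
        using log_pairing_combine[OF \<Phi> \<Phi> T My] by (simp add: algebra_simps)
      also have "norm \<dots> \<le> B * (K * tail_bound T)"
        unfolding real_norm_def abs_mult using K[OF T My y] B[OF y] by (intro mult_mono) auto
      finally show "norm (g y * log_pairing \<Phi> \<Phi> 1 (M * y) y - g y * log_pairing \<Phi> \<Phi> 1 T y) \<le> B * (K * tail_bound T)" .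
    qed
    with d(2) m_less show ?thesis by simp
  qed
  have "((\<lambda>T. - (B * (K * tail_bound T) * (Y - m))) \<longlongrightarrow> - (B * (K * 0) * (Y - m))) at_top"
    by (intro tendsto_intros tendsto_tail_bound)
  then have "((\<lambda>T. - (B * (K * tail_bound T) * (Y - m))) \<longlongrightarrow> 0) at_top" by simp
  moreover have "\<forall>\<^sub>F T in at_top. - (B * (K * tail_bound T) * (Y - m)) \<le> log_form \<Phi> \<Phi> T"
    using eventually_ge_at_top[of "1::real"] by eventually_elim (rule lower)
  ultimately show ?thesis by (intro tendsto_le[OF _ L]) auto
qed

end

section \<open>Limits and quadratic forms of cosines\<close>

text \<open>
  The Cauchy criterion at infinity, together with the bound that the limit inherits.
\<close>
lemma limit_from_tail_bound:
  fixes f :: "real \<Rightarrow> real"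
  assumes f: "\<And>T T'. 1 \<le> T \<Longrightarrow> T \<le> T' \<Longrightarrow> \<bar>f T' - f T\<bar> \<le> K * tail_bound T"
  obtains L where "(f \<longlongrightarrow> L) at_top" "\<And>T. 1 \<le> T \<Longrightarrow> \<bar>L - f T\<bar> \<le> K * tail_bound T"
proof -
  have null: "((\<lambda>T. K * tail_bound T) \<longlongrightarrow> 0) at_top"
    using tendsto_mult[OF tendsto_const tendsto_tail_bound, of K] by simp
  define X where "X n = f (real (Suc n))" for n
  have lim: "filterlim (\<lambda>n. real (Suc n)) at_top sequentially"
    by (rule filterlim_compose[OF filterlim_real_sequentially filterlim_Suc])
  have "Cauchy X"
  proof (rule metric_CauchyI)
    fix e :: real assume "e > 0"
    with filterlim_compose[OF null lim] have "\<forall>\<^sub>F n in sequentially. \<bar>K * tail_bound (real (Suc n))\<bar> < e"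
      by (simp add: tendsto_iff dist_real_def)
    then obtain M where M: "\<And>n. n \<ge> M \<Longrightarrow> \<bar>K * tail_bound (real (Suc n))\<bar> < e"
      by (auto simp: eventually_sequentially)
    have le: "dist (X p) (X n) < e" if "n \<ge> M" "n \<le> p" for n p
      using f[of "real (Suc n)" "real (Suc p)"] M[OF that(1)] that(2) by (simp add: X_def dist_real_def)
    show "\<exists>M. \<forall>m\<ge>M. \<forall>n\<ge>M. dist (X m) (X n) < e"
    proof (intro exI allI impI)
      fix p n assume "p \<ge> M" "n \<ge> M"
      then show "dist (X p) (X n) < e"
        using le[of n p] le[of p n] by (cases "n \<le> p") (auto simp: dist_commute)
    qed
  qed
  then obtain L where L: "X \<longlonglongrightarrow> L" using Cauchy_convergent convergent_def by blast
  have b: "\<bar>L - f T\<bar> \<le> K * tail_bound T" if T: "1 \<le> T" for T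
  proof (rule tendsto_upperbound)
    show "(\<lambda>n. \<bar>X n - f T\<bar>) \<longlonglongrightarrow> \<bar>L - f T\<bar>" by (intro tendsto_intros L)
    have "\<forall>\<^sub>F n in sequentially. T \<le> real (Suc n)"
      using lim by (simp add: filterlim_at_top)
    then show "\<forall>\<^sub>F n in sequentially. \<bar>X n - f T\<bar> \<le> K * tail_bound T"
      by eventually_elim (auto simp: X_def intro: f T)
  qed simp
  have "((\<lambda>T. f T - L) \<longlongrightarrow> 0) at_top"
  proof (rule Lim_null_comparison[OF _ null])
    show "\<forall>\<^sub>F T in at_top. norm (f T - L) \<le> K * tail_bound T"
      using eventually_ge_at_top[of "1::real"] by eventually_elim (use b in \<open>auto simp: abs_minus_commute\<close>)
  qed
  then have "(f \<longlongrightarrow> L) at_top" by (simp add: LIM_zero_iff)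
  with b that show thesis by blast
qed

context smooth_bump begin

lemma log_pairing_trig_sum:
  assumes x: "1 \<le> x"
  shows "log_pairing (\<lambda>w. \<Sum>i\<in>I. c i * cos (a i * w)) (\<lambda>w. \<Sum>i\<in>I. c i * cos (a i * w)) x T y =
    (\<Sum>i\<in>I. \<Sum>j\<in>I. c i * c j * log_pairing (\<lambda>w. cos (a i * w)) (\<lambda>w. cos (a j * w)) x T y)"
proof (cases "finite I")
  case I: True
  have cc: "continuous_on A (\<lambda>w. cos (b * w))" for b :: real and A by (intro continuous_intros)
  have cutoff_transform: "cutoff_transform (\<lambda>w. \<Sum>i\<in>I. c i * cos (a i * w)) y v = (\<Sum>j\<in>I. c j * cutoff_transform (\<lambda>w. cos (a j * w)) y v)" for v
  proof -
    have "((\<lambda>u. \<Sum>j\<in>I. c j * (g (u * y) * cos (a j * (u * v)))) has_integral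
        (\<Sum>j\<in>I. c j * cutoff_transform (\<lambda>w. cos (a j * w)) y v)) {1..U}"
      unfolding cutoff_transform_def
      by (intro has_integral_sum I has_integral_mult_right integrable_integral
          integrable_continuous_real continuous_intros)
    then show ?thesis
      by (simp add: cutoff_transform_def sum_distrib_left mult_ac integral_unique)
  qed
  have "((\<lambda>v. \<Sum>i\<in>I. \<Sum>j\<in>I. c i * c j * (ln v * cos (a i * v) * cutoff_transform (\<lambda>w. cos (a j * w)) y v)) has_integral
     (\<Sum>i\<in>I. \<Sum>j\<in>I. c i * c j * log_pairing (\<lambda>w. cos (a i * w)) (\<lambda>w. cos (a j * w)) x T y)) {x..T}"
    unfolding log_pairing_def
    by (intro has_integral_sum I has_integral_mult_right integrable_integral
          integrable_continuous_real continuous_intros cc) (use x in auto)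
  moreover have "(\<Sum>i\<in>I. \<Sum>j\<in>I. c i * c j * (ln v * cos (a i * v) * cutoff_transform (\<lambda>w. cos (a j * w)) y v)) =
      ln v * (\<Sum>i\<in>I. c i * cos (a i * v)) * cutoff_transform (\<lambda>w. \<Sum>i\<in>I. c i * cos (a i * w)) y v" for v
    unfolding cutoff_transform mult.assoc sum_product by (simp add: sum_distrib_left mult_ac)
  ultimately show ?thesis unfolding log_pairing_def by (simp add: integral_unique)
qed (simp add: log_pairing_def)

lemma log_form_trig_sum:
  assumes I: "finite I"
  shows "log_form (\<lambda>w. \<Sum>i\<in>I. c i * cos (a i * w)) (\<lambda>w. \<Sum>i\<in>I. c i * cos (a i * w)) T =
    (\<Sum>i\<in>I. \<Sum>j\<in>I. c i * c j * log_form (\<lambda>w. cos (a i * w)) (\<lambda>w. cos (a j * w)) T)"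
proof -
  let ?\<Phi> = "\<lambda>w. \<Sum>i\<in>I. c i * cos (a i * w)"
  have cc: "continuous_on UNIV (\<lambda>w. cos (b * w))" for b :: real by (intro continuous_intros)
  have "continuous_on UNIV ?\<Phi>" by (intro continuous_intros)
  from has_integral_log_form[OF this this, of T]
  have 1: "((\<lambda>y. g y * log_pairing ?\<Phi> ?\<Phi> 1 T y) has_integral log_form ?\<Phi> ?\<Phi> T) {m..Y}" .
  have "((\<lambda>y. \<Sum>i\<in>I. \<Sum>j\<in>I. c i * c j * (g y * log_pairing (\<lambda>w. cos (a i * w)) (\<lambda>w. cos (a j * w)) 1 T y)) has_integral
    (\<Sum>i\<in>I. \<Sum>j\<in>I. c i * c j * log_form (\<lambda>w. cos (a i * w)) (\<lambda>w. cos (a j * w)) T)) {m..Y}"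
    by (intro has_integral_sum I has_integral_mult_right has_integral_log_form cc)
  moreover have "(\<Sum>i\<in>I. \<Sum>j\<in>I. c i * c j * (g y * log_pairing (\<lambda>w. cos (a i * w)) (\<lambda>w. cos (a j * w)) 1 T y)) =
      g y * log_pairing ?\<Phi> ?\<Phi> 1 T y" for y
    by (simp add: log_pairing_trig_sum sum_distrib_left mult.assoc mult.left_commute)
  ultimately show ?thesis using has_integral_unique[OF 1] by simp
qed

lemma derivative_bound:
  obtains B where "0 \<le> B" "\<And>y. y \<in> {m..Y} \<Longrightarrow> \<bar>g y\<bar> \<le> B" "\<And>y. y \<in> {m..Y} \<Longrightarrow> \<bar>y * g' y\<bar> \<le> B"
    "\<And>y u. y \<in> {m..Y} \<Longrightarrow> u \<in> {1..U} \<Longrightarrow> \<bar>y\<^sup>2 * g'' (u * y)\<bar> \<le> B"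
proof -
  have g'c: "continuous_on UNIV g'"
    using g'_deriv by (meson DERIV_isCont continuous_at_imp_continuous_on)
  have "bounded ((\<lambda>y. g y) ` {m..Y})"
    by (intro compact_imp_bounded compact_continuous_image continuous_intros) auto
  then obtain B1 where B1: "\<And>y. y \<in> {m..Y} \<Longrightarrow> \<bar>g y\<bar> \<le> B1" by (metis bounded_iff image_eqI real_norm_def)
  have "bounded ((\<lambda>y. y * g' y) ` {m..Y})"
    by (intro compact_imp_bounded compact_continuous_image continuous_intros
        continuous_on_compose2[OF g'c]) auto
  then obtain B2 where B2: "\<And>y. y \<in> {m..Y} \<Longrightarrow> \<bar>y * g' y\<bar> \<le> B2" by (metis (no_types, lifting) bounded_iff image_eqI real_norm_def)
  have "bounded ((\<lambda>(y, u). y\<^sup>2 * g'' (u * y)) ` ({m..Y} \<times> {1..U}))"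
    unfolding case_prod_unfold
    by (intro compact_imp_bounded compact_continuous_image continuous_intros
        continuous_on_compose2[OF g''_cont] compact_Times) auto
  then obtain B3 where B3: "\<And>y u. y \<in> {m..Y} \<Longrightarrow> u \<in> {1..U} \<Longrightarrow> \<bar>y\<^sup>2 * g'' (u * y)\<bar> \<le> B3"
    by (force simp: bounded_iff)
  show thesis
  proof (rule that[of "max 0 (max B1 (max B2 B3))"])
  qed (auto simp: le_max_iff_disj B1 B2 B3)
qed

lemma log_form_cosine_bound:
  assumes d: "0 < d" "d \<le> 1"
  obtains C where "0 \<le> C"
    "\<And>a b T T'. d \<le> a \<Longrightarrow> d \<le> b \<Longrightarrow> a = b \<or> d \<le> \<bar>a - b\<bar> \<Longrightarrow> 1 \<le> T \<Longrightarrow> T \<le> T' \<Longrightarrow>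
      \<bar>log_form (\<lambda>w. cos (a * w)) (\<lambda>w. cos (b * w)) T' - log_form (\<lambda>w. cos (a * w)) (\<lambda>w. cos (b * w)) T\<bar>
        \<le> C / sqrt (a * b) * tail_bound T"
proof -
  obtain B where B: "0 \<le> B" "\<And>y. y \<in> {m..Y} \<Longrightarrow> \<bar>g y\<bar> \<le> B" "\<And>y. y \<in> {m..Y} \<Longrightarrow> \<bar>y * g' y\<bar> \<le> B"
    "\<And>y u. y \<in> {m..Y} \<Longrightarrow> u \<in> {1..U} \<Longrightarrow> \<bar>y\<^sup>2 * g'' (u * y)\<bar> \<le> B"
    using derivative_bound by metis
  define D where "D = 12 * B * U * (1 + U / d) / d"
  have D: "0 \<le> D" using B U_gt_1 d by (auto simp: D_def)
  have cc: "continuous_on UNIV (\<lambda>w. cos (b * w))" for b :: real by (intro continuous_intros)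
  show thesis
  proof (rule that[of "B * D * (Y - m)"])
    show "0 \<le> B * D * (Y - m)" using B D m_less by simp
    fix a b T T' :: real assume ab: "d \<le> a" "d \<le> b" "a = b \<or> d \<le> \<bar>a - b\<bar>" and T: "1 \<le> T" "T \<le> T'"
    let ?a = "\<lambda>w. cos (a * w)" and ?b = "\<lambda>w. cos (b * w)"
    have "norm (log_form ?a ?b T' - log_form ?a ?b T)
        \<le> B * (D * tail_bound T / sqrt (a * b)) * measure lborel {m..Y}"
    proof (rule has_integral_bound_real[OF _ finite.emptyI
          has_integral_diff[OF has_integral_log_form[OF cc cc] has_integral_log_form[OF cc cc]]])
      show "0 \<le> B * (D * tail_bound T / sqrt (a * b))"
        using B D tail_bound_pos[OF T(1)] ab d by (intro mult_nonneg_nonneg divide_nonneg_nonneg) auto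
      fix y assume "y \<in> {m..Y} - {}"
      then have y: "y \<in> {m..Y}" "m \<le> y" by auto
      have "g y * log_pairing ?a ?b 1 T' y - g y * log_pairing ?a ?b 1 T y = g y * log_pairing ?a ?b T T' y"
        by (simp add: log_pairing_combine[OF cc cc T] distrib_left)
      also have "norm \<dots> \<le> B * (D * tail_bound T / sqrt (a * b))"
        unfolding real_norm_def abs_mult D_def
        using log_pairing_cosine_bound[OF y(2) T B(2)[OF y(1)] B(3)[OF y(1)] B(4)[OF y(1)] d ab] B(2)[OF y(1)] B(1)
        by (intro mult_mono) auto
      finally show "norm (g y * log_pairing ?a ?b 1 T' y - g y * log_pairing ?a ?b 1 T y) \<le> B * (D * tail_bound T / sqrt (a * b))" .
    qed
    then show "\<bar>log_form ?a ?b T' - log_form ?a ?b T\<bar> \<le> B * D * (Y - m) / sqrt (a * b) * tail_bound T"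
      using m_less by (simp add: mult_ac)
  qed
qed

text \<open>
  The constant depends on the frequencies only through their lower bound \<open>d\<close>; this uniformity is
  what makes the sum over all frequencies converge. The bound on the limit is the tail bound at
  \<open>T = 1\<close>, where the truncated integral is zero.
\<close>
lemma log_form_cosine_limit:
  assumes d: "0 < d" "d \<le> 1"
  obtains C where "0 \<le> C"
    "\<And>a b. d \<le> a \<Longrightarrow> d \<le> b \<Longrightarrow> a = b \<or> d \<le> \<bar>a - b\<bar> \<Longrightarrow>
      \<exists>L. (log_form (\<lambda>w. cos (a * w)) (\<lambda>w. cos (b * w)) \<longlongrightarrow> L) at_top \<and> \<bar>L\<bar> \<le> C / sqrt (a * b)"
proof -
  obtain C where C: "0 \<le> C" "\<And>a b T T'. d \<le> a \<Longrightarrow> d \<le> b \<Longrightarrow> a = b \<or> d \<le> \<bar>a - b\<bar> \<Longrightarrow> 1 \<le> T \<Longrightarrow> T \<le> T' \<Longrightarrow>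
      \<bar>log_form (\<lambda>w. cos (a * w)) (\<lambda>w. cos (b * w)) T' - log_form (\<lambda>w. cos (a * w)) (\<lambda>w. cos (b * w)) T\<bar>
        \<le> C / sqrt (a * b) * tail_bound T"
    using log_form_cosine_bound[OF d] by metis
  show thesis
  proof (rule that[of "2 * C"])
    fix a b assume ab: "d \<le> a" "d \<le> b" "a = b \<or> d \<le> \<bar>a - b\<bar>"
    let ?f = "log_form (\<lambda>w. cos (a * w)) (\<lambda>w. cos (b * w))"
    from limit_from_tail_bound[of ?f, OF C(2)[OF ab]]
    obtain L where L: "(?f \<longlongrightarrow> L) at_top" "\<And>T. 1 \<le> T \<Longrightarrow> \<bar>L - ?f T\<bar> \<le> C / sqrt (a * b) * tail_bound T"
      by metis
    from L(2)[of 1] have "\<bar>L\<bar> \<le> 2 * C / sqrt (a * b)"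
      by (simp add: log_form_def tail_bound_def mult.commute)
    with L(1) show "\<exists>L. (?f \<longlongrightarrow> L) at_top \<and> \<bar>L\<bar> \<le> 2 * C / sqrt (a * b)" by blast
  qed (use C in simp)
qed

text \<open>
  Apply \<open>log_form_limit_nonneg\<close> to the trigonometric sum with coefficients \<open>c\<close>. As there are only
  finitely many frequencies, some \<open>d > 0\<close> bounds all of them and their nonzero differences from
  below.
\<close>
lemma quadratic_form_nonneg:
  assumes I: "finite I" and a: "\<And>i. i \<in> I \<Longrightarrow> 0 < a i"
    and L: "\<And>i j. i \<in> I \<Longrightarrow> j \<in> I \<Longrightarrow>
      (log_form (\<lambda>w. cos (a i * w)) (\<lambda>w. cos (a j * w)) \<longlongrightarrow> L i j) at_top"
  shows "0 \<le> (\<Sum>i\<in>I. \<Sum>j\<in>I. c i * c j * L i j)"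
proof -
  let ?\<Phi> = "\<lambda>w. \<Sum>i\<in>I. c i * cos (a i * w)"
  obtain B where B: "0 \<le> B" "\<And>y. y \<in> {m..Y} \<Longrightarrow> \<bar>g y\<bar> \<le> B" "\<And>y. y \<in> {m..Y} \<Longrightarrow> \<bar>y * g' y\<bar> \<le> B"
    "\<And>y u. y \<in> {m..Y} \<Longrightarrow> u \<in> {1..U} \<Longrightarrow> \<bar>y\<^sup>2 * g'' (u * y)\<bar> \<le> B"
    using derivative_bound by metis
  define E where "E = insert 1 (a ` I \<union> {\<bar>a i - a j\<bar> | i j. i \<in> I \<and> j \<in> I \<and> a i \<noteq> a j})"
  define d where "d = Min E"
  have "{\<bar>a i - a j\<bar> | i j. i \<in> I \<and> j \<in> I \<and> a i \<noteq> a j} \<subseteq> (\<lambda>(i, j). \<bar>a i - a j\<bar>) ` (I \<times> I)"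
    by auto
  from finite_subset[OF this] have E: "finite E" using I by (simp add: E_def)
  have d: "0 < d" "d \<le> 1"
    using E a by (auto simp: d_def E_def[symmetric] Min_gr_iff intro!: Min_le) (auto simp: E_def)
  have da: "d \<le> a i" if "i \<in> I" for i
    unfolding d_def using that by (intro Min_le E) (auto simp: E_def)
  have dd: "a i = a j \<or> d \<le> \<bar>a i - a j\<bar>" if "i \<in> I" "j \<in> I" for i j
    unfolding d_def using that E by (auto intro!: Min_le) (auto simp: E_def)
  define D where "D = 12 * B * U * (1 + U / d) / d"
  define K where "K = (\<Sum>i\<in>I. \<Sum>j\<in>I. \<bar>c i * c j\<bar> * (D / sqrt (a i * a j)))"
  show ?thesis
  proof (rule log_form_limit_nonneg[where \<Phi> = ?\<Phi> and K = K and B = B])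
    show "continuous_on UNIV ?\<Phi>" by (intro continuous_intros)
    show "(log_form ?\<Phi> ?\<Phi> \<longlongrightarrow> (\<Sum>i\<in>I. \<Sum>j\<in>I. c i * c j * L i j)) at_top"
      unfolding log_form_trig_sum[OF I] by (intro tendsto_intros L)
    show "\<bar>g y\<bar> \<le> B" if "y \<in> {m..Y}" for y using B(2)[OF that] .
    fix x T y :: real assume x: "1 \<le> x" "x \<le> T" and y: "y \<in> {m..Y}"
    then have my: "m \<le> y" by simp
    have "\<bar>log_pairing ?\<Phi> ?\<Phi> x T y\<bar> \<le> (\<Sum>i\<in>I. \<Sum>j\<in>I.
        \<bar>c i * c j * log_pairing (\<lambda>w. cos (a i * w)) (\<lambda>w. cos (a j * w)) x T y\<bar>)"
      unfolding log_pairing_trig_sum[OF x(1)] by (intro order.trans[OF sum_abs] sum_mono sum_abs)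
    also have "\<dots> \<le> (\<Sum>i\<in>I. \<Sum>j\<in>I. \<bar>c i * c j\<bar> * (D * tail_bound x / sqrt (a i * a j)))"
      unfolding abs_mult[of "_ * _" "log_pairing _ _ _ _ _"] D_def
      by (intro sum_mono mult_left_mono log_pairing_cosine_bound my x B(2)[OF y] B(3)[OF y] B(4)[OF y] d da dd) auto
    also have "\<dots> = K * tail_bound x"
      by (simp add: K_def sum_distrib_left sum_distrib_right mult_ac)
    finally show "\<bar>log_pairing ?\<Phi> ?\<Phi> x T y\<bar> \<le> K * tail_bound x" .
  qed
qed

end

section \<open>Sums over integers with bounded prime factors\<close>

lemma summable_on_mult_Times:
  fixes f :: "'a \<Rightarrow> real" and g :: "'b \<Rightarrow> real"
  assumes "f summable_on A" "g summable_on B"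
    and "\<And>x. x \<in> A \<Longrightarrow> 0 \<le> f x" "\<And>y. y \<in> B \<Longrightarrow> 0 \<le> g y"
  shows "(\<lambda>(x, y). f x * g y) summable_on A \<times> B"
proof (rule summable_on_SigmaI)
  fix x assume "x \<in> A"
  show "((\<lambda>y. case (x, y) of (x, y) \<Rightarrow> f x * g y) has_sum f x * infsum g B) B"
    using has_sum_cmult_right[OF has_sum_infsum[OF assms(2)], of "f x"] by simp
next
  show "(\<lambda>x. f x * infsum g B) summable_on A"
    by (intro summable_on_cmult_left assms)
qed (use assms in auto)

text \<open>
  The multiplicative monoid generated by \<open>P\<close>, when \<open>P\<close> is a set of primes.
\<close>
definition supported_on :: "nat set \<Rightarrow> nat set" where
  "supported_on P = {n. 0 < n \<and> (\<forall>q. prime q \<and> q dvd n \<longrightarrow> q \<in> P)}"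

lemma supported_on_empty: "supported_on {} \<subseteq> {1}"
proof
  fix n assume n: "n \<in> supported_on {}"
  then have "\<not> (\<exists>q. prime q \<and> q dvd n)" by (auto simp: supported_on_def)
  then show "n \<in> {1}" using prime_factor_nat[of n] by auto
qed

text \<open>
  The convergence of a finite Euler product: splitting off the power of one prime \<open>p\<close> embeds the
  integers supported on \<open>insert p P\<close> into pairs of an exponent and an integer supported on \<open>P\<close>,
  and the summand factors into a geometric term and the term for \<open>P\<close>.
\<close>
lemma summable_inverse_sqrt_supported_on:
  assumes "finite P" "\<And>p. p \<in> P \<Longrightarrow> prime p"
  shows "(\<lambda>n. 1 / sqrt (real n)) summable_on supported_on P"
  using assms
proof (induction P)
  case empty
  then show ?case
    using summable_on_subset[OF summable_on_finite supported_on_empty] by blast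
next
  case (insert p P)
  have p: "prime p" using insert.prems by simp
  then have p1: "1 < p" by (rule prime_gt_1_nat)
  define h where "h n = (multiplicity p n, n div p ^ multiplicity p n)" for n
  have dec: "n = p ^ fst (h n) * snd (h n)" for n
    by (simp add: h_def multiplicity_dvd)
  have inj: "inj_on h A" for A
    by (rule inj_onI) (metis dec)
  have sub: "h ` supported_on (insert p P) \<subseteq> UNIV \<times> supported_on P"
  proof (clarsimp simp: h_def)
    fix n assume n: "n \<in> supported_on (insert p P)"
    then have n0: "n \<noteq> 0" by (simp add: supported_on_def)
    have nd: "\<not> p dvd n div p ^ multiplicity p n"
      by (rule multiplicity_decompose) (use n0 p1 in auto)
    have dv: "n div p ^ multiplicity p n dvd n"
      using dec[of n] by (metis dvd_triv_right h_def snd_conv)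
    show "n div p ^ multiplicity p n \<in> supported_on P"
      unfolding supported_on_def
    proof (intro CollectI conjI allI impI)
      show "0 < n div p ^ multiplicity p n" using dv n0 by (metis dvd_0_left gr0I)
      fix q assume q: "prime q \<and> q dvd n div p ^ multiplicity p n"
      with dv n have "q \<in> insert p P" unfolding supported_on_def by (auto intro: dvd_trans)
      with q nd show "q \<in> P" by auto
    qed
  qed
  have "summable (\<lambda>j. (1 / sqrt (real p)) ^ j)"
    using p1 by (intro summable_geometric) auto
  then have "(\<lambda>j. (1 / sqrt (real p)) ^ j) summable_on UNIV"
    by (intro summable_nonneg_imp_summable_on) auto
  moreover have "(\<lambda>n. 1 / sqrt (real n)) summable_on supported_on P"
    using insert by simp
  ultimately have "(\<lambda>(j, n). (1 / sqrt (real p)) ^ j * (1 / sqrt (real n))) summable_on UNIV \<times> supported_on P"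
    by (rule summable_on_mult_Times) auto
  from summable_on_subset[OF this sub]
  have "((\<lambda>(j, n). (1 / sqrt (real p)) ^ j * (1 / sqrt (real n))) \<circ> h) summable_on supported_on (insert p P)"
    by (simp add: summable_on_reindex[OF inj])
  moreover have "((\<lambda>(j, n). (1 / sqrt (real p)) ^ j * (1 / sqrt (real n))) \<circ> h) n = 1 / sqrt (real n)" for n
  proof -
    have "sqrt (real n) = sqrt (real p) ^ fst (h n) * sqrt (real (snd (h n)))"
      by (subst dec[of n]) (simp add: real_sqrt_mult real_sqrt_power)
    then show ?thesis by (simp add: case_prod_unfold power_one_over)
  qed
  ultimately show ?case by (simp only: comp_def)
qed

lemma finite_primes_below: "finite {p. prime p \<and> real p < B}"
proof (rule finite_subset)
  show "{p. prime p \<and> real p < B} \<subseteq> {..nat \<lceil>B\<rceil>}" by (auto simp: le_nat_iff) linarith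
qed simp

lemma N_S_eq_supported_on: "N_S B = supported_on {p. prime p \<and> real p < B}"
  by (auto simp: N_S_def supported_on_def)

lemma summable_inverse_sqrt_N_S: "(\<lambda>n. 1 / sqrt (real n)) summable_on N_S B"
  unfolding N_S_eq_supported_on
  by (rule summable_inverse_sqrt_supported_on) (auto simp: finite_primes_below)

text \<open>
  A squarefree number is the product of its prime factors, hence determined by a subset of a
  finite set of primes.
\<close>
lemma finite_squarefree_N_S: "finite {n \<in> N_S B. squarefree n}"
proof (rule inj_on_finite)
  show "inj_on prime_factors {n \<in> N_S B. squarefree n}"
  proof (rule inj_onI)
    fix a b assume "a \<in> {n \<in> N_S B. squarefree n}" "b \<in> {n \<in> N_S B. squarefree n}"
      and eq: "prime_factors a = prime_factors b"
    moreover have "n = \<Prod>(prime_factors n)" if "squarefree n" "0 < n" for n :: nat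
    proof -
      have "n = (\<Prod>p\<in>prime_factors n. p ^ multiplicity p n)"
        using that by (simp add: prime_factorization_nat)
      also have "\<dots> = \<Prod>(prime_factors n)"
        using that by (intro prod.cong) (auto simp: squarefree_factorial_semiring')
      finally show ?thesis .
    qed
    ultimately show "a = b" by (metis (no_types, lifting) N_S_def mem_Collect_eq)
  qed
  show "prime_factors ` {n \<in> N_S B. squarefree n} \<subseteq> Pow {p. prime p \<and> real p < B}"
    by (auto simp: N_S_def prime_factors_dvd)
qed (simp add: finite_primes_below)

lemma moebius_bound: "\<bar>real_of_int (moebius n)\<bar> \<le> (if squarefree n then 1 else 0)"
  by (auto simp: moebius_def power_abs)

text \<open>
  Every finite set of quadruples lies in a box \<open>X \<times> X \<times> X \<times> X\<close> with \<open>X\<close> finite, so boxes suffice to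
  compute the sum.
\<close>
lemma infsum_nonneg_if_boxes_nonneg:
  fixes f :: "'a \<times> 'a \<times> 'a \<times> 'a \<Rightarrow> real"
  assumes f: "f summable_on A \<times> A \<times> A \<times> A"
    and box: "\<And>X. finite X \<Longrightarrow> X \<subseteq> A \<Longrightarrow> 0 \<le> sum f (X \<times> X \<times> X \<times> X)"
  shows "0 \<le> infsum f (A \<times> A \<times> A \<times> A)"
proof (rule ccontr)
  assume "\<not> 0 \<le> infsum f (A \<times> A \<times> A \<times> A)"
  then have "infsum f (A \<times> A \<times> A \<times> A) < 0" by simp
  with infsum_tendsto[OF f]
  have "\<forall>\<^sub>F F in finite_subsets_at_top (A \<times> A \<times> A \<times> A). sum f F < 0"
    by (rule order_tendstoD)
  then obtain F where F: "finite F" "F \<subseteq> A \<times> A \<times> A \<times> A"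
    "\<forall>G. finite G \<and> F \<subseteq> G \<and> G \<subseteq> A \<times> A \<times> A \<times> A \<longrightarrow> sum f G < 0"
    unfolding eventually_finite_subsets_at_top by blast
  define X where "X = (\<Union>p\<in>F. {fst p, fst (snd p), fst (snd (snd p)), snd (snd (snd p))})"
  have "fst p \<in> A" "fst (snd p) \<in> A" "fst (snd (snd p)) \<in> A" "snd (snd (snd p)) \<in> A" if "p \<in> F" for p
    using subsetD[OF F(2) that] by (simp_all add: mem_Times_iff)
  then have X: "finite X" "X \<subseteq> A" using F(1) by (auto simp: X_def)
  have "F \<subseteq> X \<times> X \<times> X \<times> X"
    unfolding subset_iff mem_Times_iff X_def by blast
  moreover have "finite (X \<times> X \<times> X \<times> X)" "X \<times> X \<times> X \<times> X \<subseteq> A \<times> A \<times> A \<times> A"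
    using X by (auto intro!: finite_cartesian_product)
  ultimately have "sum f (X \<times> X \<times> X \<times> X) < 0" using F(3) by blast
  with box[OF X] show False by simp
qed

section \<open>Smooth functions on the half-line and their autocorrelation\<close>

text \<open>
  Iterated derivatives depend only on the germ of a function, so smoothness can be checked on an
  open cover.
\<close>
lemma iterated_deriv_cong_open:
  fixes f f' :: "real \<Rightarrow> real"
  assumes S: "open S" and eq: "\<And>x. x \<in> S \<Longrightarrow> f x = f' x" and "x \<in> S"
  shows "(deriv ^^ n) f x = (deriv ^^ n) f' x"
  using \<open>x \<in> S\<close>
proof (induction n arbitrary: x)
  case (Suc n)
  have "\<forall>\<^sub>F y in nhds x. (deriv ^^ n) f y = (deriv ^^ n) f' y"
    using eventually_nhds_in_open[OF S Suc.prems] by eventually_elim (rule Suc.IH)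
  then show ?case by (simp add: deriv_cong_ev)
qed (simp add: eq)

lemma iterated_deriv_zero: "(deriv ^^ n) (\<lambda>_. 0 :: real) = (\<lambda>_. 0 :: real)"
  by (induction n) auto

definition zero_ext :: "(real \<Rightarrow> real) \<Rightarrow> real \<Rightarrow> real" where
  "zero_ext g x = (if 0 < x then g x else 0)"

lemma zero_ext_off_supp: "x \<notin> supp_pos g \<Longrightarrow> zero_ext g x = 0"
  using closure_subset[of "{x. 0 < x \<and> g x \<noteq> 0}"] by (auto simp: supp_pos_def zero_ext_def)

lemma iterated_deriv_zero_ext_off_supp:
  assumes "x \<notin> supp_pos g" shows "(deriv ^^ n) (zero_ext g) x = 0"
proof -
  have "open (- supp_pos g)" by (simp add: supp_pos_def open_Compl)
  then have "(deriv ^^ n) (zero_ext g) x = (deriv ^^ n) (\<lambda>_. 0) x"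
    by (rule iterated_deriv_cong_open) (use assms zero_ext_off_supp in auto)
  then show ?thesis by (simp add: iterated_deriv_zero)
qed

text \<open>
  Extending by zero preserves smoothness: the line is covered by \<open>(0, \<infinity>)\<close>, where the extension
  agrees with \<open>g\<close>, and by the complement of the support, where it is zero.
\<close>
lemma iterated_deriv_zero_ext:
  assumes g: "g \<in> Cc_infinity_pos"
  shows "((deriv ^^ n) (zero_ext g) has_real_derivative (deriv ^^ Suc n) (zero_ext g) x) (at x)"
proof -
  have "(deriv ^^ n) (zero_ext g) field_differentiable at x"
  proof (cases "x \<in> supp_pos g")
    case True
    with g have x: "0 < x" by (auto simp: Cc_infinity_pos_def)
    have "\<forall>\<^sub>F y in nhds x. (deriv ^^ n) (zero_ext g) y = (deriv ^^ n) g y"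
      using eventually_nhds_in_open[OF open_greaterThan, of x 0] x
      by (auto elim!: eventually_mono intro!: iterated_deriv_cong_open[of "{0<..}"] simp: zero_ext_def)
    moreover have "(deriv ^^ n) g field_differentiable at x"
      using g x by (auto simp: Cc_infinity_pos_def)
    ultimately show ?thesis
      unfolding field_differentiable_def using DERIV_cong_ev[OF refl _ refl] by blast
  next
    case False
    have op: "open (- supp_pos g)" by (simp add: supp_pos_def open_Compl)
    have "\<forall>\<^sub>F y in nhds x. (deriv ^^ n) (zero_ext g) y = 0"
      using eventually_nhds_in_open[OF op, of x] False
      by (auto elim!: eventually_mono intro: iterated_deriv_zero_ext_off_supp)
    from DERIV_cong_ev[OF refl this refl, of 0] show ?thesis
      unfolding field_differentiable_def by auto
  qed
  then show ?thesis by (simp add: DERIV_deriv_iff_field_differentiable)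
qed

lemma set_integral_eq_integral_continuous:
  fixes f :: "real \<Rightarrow> real"
  assumes "continuous_on {a..b} f"
  shows "(LINT x:{a..b}|lborel. f x) = integral {a..b} f"
  by (rule set_borel_integral_eq_integral(2)[OF borel_integrable_atLeastAtMost'[OF assms]])

context smooth_bump begin

lemma autocorr_cont: "continuous_on A autocorr"
proof -
  have "continuous_on (A \<times> cbox m Y) (\<lambda>(u, y). g (u * y) * g y)"
    unfolding case_prod_unfold by (intro continuous_intros)
  from integral_continuous_on_param[OF this] show ?thesis by (simp add: autocorr_def[abs_def])
qed

lemma autocorr_zero: "u \<ge> U \<Longrightarrow> autocorr u = 0"
proof -
  assume u: "u \<ge> U"
  have "autocorr u = integral {m..Y} (\<lambda>_. 0)"
    unfolding autocorr_def
  proof (rule Henstock_Kurzweil_Integration.integral_cong)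
    fix y assume y: "y \<in> {m..Y}"
    with m_pos have "U * y \<le> u * y" by (intro mult_right_mono u) auto
    with y Y_le_U_times[of y] show "g (u * y) * g y = 0" by (simp add: g_zero)
  qed
  then show ?thesis by simp
qed

lemma inner_integral_eq:
  assumes h: "\<And>u. 1 \<le> u \<Longrightarrow> h u = autocorr u"
  shows "inner_integral h k l v = integral {1..U} (\<lambda>u. autocorr u * cos (2 * pi * real l / real k * (u * v)))"
proof -
  let ?f = "\<lambda>u. autocorr u * cos (2 * pi * real l / real k * (u * v))"
  have "inner_integral h k l v = (LINT u:{1..U}|lborel. ?f u)"
    unfolding inner_integral_def set_lebesgue_integral_def
    by (intro Bochner_Integration.integral_cong refl)
       (auto simp: indicator_def h autocorr_zero mult_ac)
  also have "\<dots> = integral {1..U} ?f"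
    by (intro set_integral_eq_integral_continuous continuous_intros autocorr_cont)
  finally show ?thesis .
qed

lemma outer_partial_eq_log_form:
  assumes h: "\<And>u. 1 \<le> u \<Longrightarrow> h u = autocorr u"
  shows "outer_partial h k1 k2 l1 l2 =
    log_form (\<lambda>w. cos (2 * pi * real l1 / real k1 * w)) (\<lambda>w. cos (2 * pi * real l2 / real k2 * w))"
proof
  fix T
  let ?f = "\<lambda>v. ln v * cos (2 * pi * real l1 / real k1 * v) *
    integral {1..U} (\<lambda>u. autocorr u * cos (2 * pi * real l2 / real k2 * (u * v)))"
  have "continuous_on (UNIV \<times> cbox 1 U) (\<lambda>(v, u). autocorr u * cos (2 * pi * real l2 / real k2 * (u * v)))"
    unfolding case_prod_unfold by (intro continuous_intros continuous_on_compose2[OF autocorr_cont[of UNIV]]) auto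
  from integral_continuous_on_param[OF this]
  have c: "continuous_on A (\<lambda>v. integral {1..U} (\<lambda>u. autocorr u * cos (2 * pi * real l2 / real k2 * (u * v))))" for A
    using continuous_on_subset by fastforce
  have "outer_partial h k1 k2 l1 l2 T = (LINT v:{1..T}|lborel. ?f v)"
    by (simp add: outer_partial_def inner_integral_eq[OF h])
  also have "\<dots> = integral {1..T} ?f"
    by (intro set_integral_eq_integral_continuous continuous_intros c) auto
  finally show "outer_partial h k1 k2 l1 l2 T =
    log_form (\<lambda>w. cos (2 * pi * real l1 / real k1 * w)) (\<lambda>w. cos (2 * pi * real l2 / real k2 * w)) T"
    by (simp add: log_form_def)
qed

end

section \<open>Spacing of the frequencies\<close>

definition freq :: "nat \<Rightarrow> nat \<Rightarrow> real" where
  "freq k l = 2 * pi * real l / real k"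

lemma freq_ge:
  assumes "0 < k" "0 < l" "k \<le> R"
  shows "1 / (real R)\<^sup>2 \<le> freq k l"
proof -
  have k: "1 \<le> real k" "real k \<le> real R" "1 \<le> real l" using assms by auto
  have "real k * 1 \<le> real R * real R" using k by (intro mult_mono) auto
  then have "1 / (real R)\<^sup>2 \<le> 1 / real k" using k by (intro divide_left_mono) (auto simp: power2_eq_square)
  also have "\<dots> \<le> freq k l"
  proof -
    have "1 * 1 \<le> (2 * pi) * real l" using k pi_gt3 by (intro mult_mono) auto
    then show ?thesis unfolding freq_def by (intro divide_right_mono) auto
  qed
  finally show ?thesis .
qed

text \<open>
  Rational numbers with denominators at most \<open>R\<close> that differ do so by at least \<open>1 / R\<^sup>2\<close>,
  and the factor \<open>2 \<pi>\<close> in the frequencies only enlarges the gap.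
\<close>
lemma freq_gap:
  assumes k: "0 < k1" "0 < k2" "k1 \<le> R" "k2 \<le> R"
  shows "freq k1 l1 = freq k2 l2 \<or> 1 / (real R)\<^sup>2 \<le> \<bar>freq k1 l1 - freq k2 l2\<bar>"
proof (cases "int l1 * int k2 = int l2 * int k1")
  case True
  then have "real l1 * real k2 = real l2 * real k1" by (metis of_nat_eq_iff of_nat_mult)
  then show ?thesis using k by (simp add: freq_def field_simps)
next
  case False
  have "real k1 * real k2 \<le> real R * real R" using k by (intro mult_mono) auto
  then have "1 / (real R)\<^sup>2 \<le> 1 / (real k1 * real k2)"
    using k by (intro divide_left_mono) (auto simp: power2_eq_square)
  also have "\<dots> \<le> 2 * pi * real_of_int \<bar>int l1 * int k2 - int l2 * int k1\<bar> / (real k1 * real k2)"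
  proof (rule divide_right_mono)
    have "1 \<le> \<bar>int l1 * int k2 - int l2 * int k1\<bar>" using False by linarith
    then have "1 \<le> real_of_int \<bar>int l1 * int k2 - int l2 * int k1\<bar>" by linarith
    then have "1 * 1 \<le> (2 * pi) * real_of_int \<bar>int l1 * int k2 - int l2 * int k1\<bar>"
      using pi_gt3 by (intro mult_mono) auto
    then show "1 \<le> 2 * pi * real_of_int \<bar>int l1 * int k2 - int l2 * int k1\<bar>" by simp
  qed simp
  also have "\<dots> = \<bar>2 * pi * (real l1 * real k2 - real l2 * real k1) / (real k1 * real k2)\<bar>"
    by (simp add: abs_mult)
  also have "2 * pi * (real l1 * real k2 - real l2 * real k1) / (real k1 * real k2) = freq k1 l1 - freq k2 l2"
    using k by (simp add: freq_def field_simps)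
  finally show ?thesis by blast
qed

text \<open>
  This converts decay in the frequencies into decay in \<open>l1\<close> and \<open>l2\<close>; what is lost is
  compensated by the denominator \<open>k1 * k2\<close> of the summand.
\<close>
lemma sqrt_freq_mult_ge:
  assumes "0 < k1" "0 < k2"
  shows "sqrt (real l1) * sqrt (real l2) / (real k1 * real k2) \<le> sqrt (freq k1 l1 * freq k2 l2)"
proof -
  let ?k = "real k1 * real k2"
  have "1 * 1 \<le> ?k" using assms by (intro mult_mono) auto
  then have k: "1 \<le> ?k" by simp
  have "sqrt (real l1) * sqrt (real l2) / ?k = sqrt (real l1 * real l2 / ?k\<^sup>2)"
    using k by (simp add: real_sqrt_mult real_sqrt_divide)
  also have "\<dots> \<le> sqrt (freq k1 l1 * freq k2 l2)"
  proof (rule real_sqrt_le_mono)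
    have "real l1 * real l2 / ?k\<^sup>2 \<le> real l1 * real l2 / ?k"
    proof (rule divide_left_mono)
      have "?k * 1 \<le> ?k * ?k" using k by (intro mult_left_mono) auto
      then show "?k \<le> ?k\<^sup>2" by (simp add: power2_eq_square)
    qed (use assms in auto)
    also have "\<dots> \<le> (2 * pi) * (2 * pi) * (real l1 * real l2 / ?k)"
    proof -
      have "1 * 1 \<le> (2 * pi) * (2 * pi)" using pi_gt3 by (intro mult_mono) auto
      then have "1 * (real l1 * real l2 / ?k) \<le> (2 * pi) * (2 * pi) * (real l1 * real l2 / ?k)"
        by (intro mult_right_mono) auto
      then show ?thesis by simp
    qed
    also have "\<dots> = freq k1 l1 * freq k2 l2" by (simp add: freq_def)
    finally show "real l1 * real l2 / ?k\<^sup>2 \<le> freq k1 l1 * freq k2 l2" .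
  qed
  finally show ?thesis .
qed

section \<open>Positivity of the sum\<close>

theorem corollary1p5:
  fixes \<mu> :: real and g h :: "real \<Rightarrow> real"
  assumes mu: "0 < \<mu>" "\<mu> < 1"
    and g: "g \<in> Cc_infinity_pos"
    and supp_g: "supp_pos g \<subseteq> {sqrt \<mu> <..< \<mu> powr (-1/2)}"
    and h: "\<And>x. 0 < x \<Longrightarrow> h x = (LINT y:{0<..}|lborel. g (x * y) * g y)"
    and h0: "mellin h 0 = 0"
    and h1: "mellin h 1 = 0"
  defines "N \<equiv> N_S (1 / \<mu>)"
  shows "(\<forall>k1\<in>N. \<forall>k2\<in>N. \<forall>l1\<in>N. \<forall>l2\<in>N. \<exists>L. (outer_partial h k1 k2 l1 l2 \<longlongrightarrow> L) at_top)
       \<and> sum_term h summable_on (N \<times> N \<times> N \<times> N)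
       \<and> (\<Sum>\<^sub>\<infinity>k\<in>N \<times> N \<times> N \<times> N. sum_term h k) \<ge> 0"
proof -
  define m Y g0 where "m = sqrt \<mu>" and "Y = \<mu> powr (-1/2)" and "g0 = zero_ext g"
  have Y: "Y = 1 / m" using mu by (simp add: Y_def m_def powr_minus_divide powr_half_sqrt)
  have m: "0 < m" "m < 1" using mu by (simp_all add: m_def)
  have U: "1 / \<mu> = Y / m" using mu unfolding Y by (simp add: m_def)
  have off: "x \<notin> supp_pos g" if "x \<le> m \<or> x \<ge> Y" for x
    using supp_g that by (auto simp: m_def Y_def)
  note d = iterated_deriv_zero_ext[OF g, folded g0_def]
  note z = iterated_deriv_zero_ext_off_supp[OF off, folded g0_def]
  interpret smooth_bump g0 "deriv g0" "deriv (deriv g0)" m Y "1 / \<mu>"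
  proof
    have "1 < 1 / m" using m by simp
    with m show "0 < m" "m < Y" by (auto simp: Y intro: less_trans[of _ 1])
    show "1 / \<mu> = Y / m" by (rule U)
    fix x
    show "(g0 has_real_derivative deriv g0 x) (at x)" using d[of 0] by simp
    show "(deriv g0 has_real_derivative deriv (deriv g0) x) (at x)" using d[of 1] by simp
    have "isCont (deriv (deriv g0)) x" for x using DERIV_isCont[OF d[of 2]] by (simp add: numeral_2_eq_2)
    then show "continuous_on UNIV (deriv (deriv g0))" by (simp add: continuous_at_imp_continuous_on)
    show "g0 x = 0" if "Y \<le> x" using z[of x 0] that by simp
    show "deriv g0 x = 0" if "Y \<le> x" using z[of x 1] that by simp
  qed
  have h_eq: "h u = autocorr u" if "1 \<le> u" for u
  proof -
    have "h u = (LINT y:{0<..}|lborel. g (u * y) * g y)" using that h by simp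
    also have "\<dots> = (LINT y:{m..Y}|lborel. g0 (u * y) * g0 y)"
      unfolding set_lebesgue_integral_def
    proof (intro Bochner_Integration.integral_cong refl)
      fix y
      have "g y = 0" if "0 < y" "y \<notin> {m..Y}"
        using zero_ext_off_supp[OF off, of y] that by (auto simp: zero_ext_def)
      then show "indicator {0<..} y *\<^sub>R (g (u * y) * g y) = indicator {m..Y} y *\<^sub>R (g0 (u * y) * g0 y)"
        using m \<open>1 \<le> u\<close> by (auto simp: indicator_def g0_def zero_ext_def zero_less_mult_iff)
    qed
    also have "\<dots> = autocorr u"
      unfolding autocorr_def by (intro set_integral_eq_integral_continuous continuous_intros)
    finally show ?thesis .
  qed
  let ?cos = "\<lambda>k l w. cos (freq k l * w)"
  have op: "outer_partial h k1 k2 l1 l2 = log_form (?cos k1 l1) (?cos k2 l2)" for k1 k2 l1 l2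
    unfolding freq_def by (rule outer_partial_eq_log_form[OF h_eq])
  have N0: "0 < n" if "n \<in> N" for n using that by (simp add: N_def N_S_def)
  (* A bound R on the denominators yields the lower bound 1 / R^2 for all frequencies and their
     nonzero differences, hence one constant C for all of them. *)
  have limit: "\<exists>C\<ge>0. \<forall>k1\<in>N. \<forall>k2\<in>N. \<forall>l1\<in>N. \<forall>l2\<in>N. k1 \<le> R \<longrightarrow> k2 \<le> R \<longrightarrow>
      (\<exists>L. (outer_partial h k1 k2 l1 l2 \<longlongrightarrow> L) at_top \<and> \<bar>L\<bar> \<le> C / sqrt (freq k1 l1 * freq k2 l2))"
    if R: "1 \<le> R" for R
  proof -
    have "0 < 1 / (real R)\<^sup>2" "1 / (real R)\<^sup>2 \<le> 1" using R by auto
    from log_form_cosine_limit[OF this] obtain C where C: "0 \<le> C"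
      "\<And>a b. 1 / (real R)\<^sup>2 \<le> a \<Longrightarrow> 1 / (real R)\<^sup>2 \<le> b \<Longrightarrow> a = b \<or> 1 / (real R)\<^sup>2 \<le> \<bar>a - b\<bar> \<Longrightarrow>
        \<exists>L. (log_form (\<lambda>w. cos (a * w)) (\<lambda>w. cos (b * w)) \<longlongrightarrow> L) at_top \<and> \<bar>L\<bar> \<le> C / sqrt (a * b)"
      by metis
    show ?thesis
      unfolding op by (intro exI[of _ C] conjI C ballI impI freq_ge freq_gap N0)
  qed
  have lim_ex: "\<exists>L. (outer_partial h k1 k2 l1 l2 \<longlongrightarrow> L) at_top"
    if "k1 \<in> N" "k2 \<in> N" "l1 \<in> N" "l2 \<in> N" for k1 k2 l1 l2
  proof -
    have "1 \<le> max k1 k2" using N0[OF that(1)] by simp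
    from limit[OF this] that show ?thesis by (meson max.cobounded1 max.cobounded2)
  qed
  have lim: "(outer_partial h k1 k2 l1 l2 \<longlongrightarrow> outer_integral h k1 k2 l1 l2) at_top"
    if "k1 \<in> N" "k2 \<in> N" "l1 \<in> N" "l2 \<in> N" for k1 k2 l1 l2
    using lim_ex[OF that] tendsto_Lim[OF trivial_limit_at_top_linorder]
    by (auto simp: outer_integral_def)
  define Q where "Q = {n \<in> N. squarefree n}"
  have Q: "finite Q" unfolding Q_def N_def by (rule finite_squarefree_N_S)
  define R where "R = Max (insert 1 Q)"
  have R: "1 \<le> R" "\<And>k. k \<in> Q \<Longrightarrow> k \<le> R" using Q by (auto simp: R_def)
  from limit[OF R(1)] obtain C where C: "0 \<le> C"
    "\<And>k1 k2 l1 l2. k1 \<in> N \<Longrightarrow> k2 \<in> N \<Longrightarrow> l1 \<in> N \<Longrightarrow> l2 \<in> N \<Longrightarrow> k1 \<le> R \<Longrightarrow> k2 \<le> R \<Longrightarrow>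
      (\<exists>L. (outer_partial h k1 k2 l1 l2 \<longlongrightarrow> L) at_top \<and> \<bar>L\<bar> \<le> C / sqrt (freq k1 l1 * freq k2 l2))"
    by blast
  have C': "\<bar>outer_integral h k1 k2 l1 l2\<bar> \<le> C / sqrt (freq k1 l1 * freq k2 l2)"
    if "k1 \<in> Q" "k2 \<in> Q" "l1 \<in> N" "l2 \<in> N" for k1 k2 l1 l2
  proof -
    have k: "k1 \<in> N" "k2 \<in> N" using that by (auto simp: Q_def)
    from C(2)[OF k that(3,4) R(2)[OF that(1)] R(2)[OF that(2)]] show ?thesis
      using tendsto_unique[OF trivial_limit_at_top_linorder lim[OF k that(3,4)]] by blast
  qed
  (* The dominating function is a product of a function of finite support in k1 and k2 and of
     1 / sqrt in l1 and l2. *)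
  define u where "u k = (if squarefree k then 1 else 0 :: real)" for k :: nat
  define w where "w l = 1 / sqrt (real l)" for l :: nat
  have u_sum: "u summable_on N"
  proof -
    have "u summable_on Q" by (rule summable_on_finite[OF Q])
    then show ?thesis
      by (rule summable_on_cong_neutral[THEN iffD1, rotated -1]) (auto simp: Q_def u_def)
  qed
  have w_sum: "w summable_on N" unfolding w_def N_def by (rule summable_inverse_sqrt_N_S)
  have uw: "0 \<le> u n" "0 \<le> w n" for n by (simp_all add: u_def w_def)
  have "(\<lambda>(k1, p). u k1 * (\<lambda>(k2, p). u k2 * (\<lambda>(l1, l2). w l1 * w l2) p) p) summable_on N \<times> N \<times> N \<times> N"
    by (intro summable_on_mult_Times u_sum w_sum) (auto simp: uw)
  from summable_on_cmult_right[OF this, of C]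
  have dom: "(\<lambda>p. C * (\<lambda>(k1, p). u k1 * (\<lambda>(k2, p). u k2 * (\<lambda>(l1, l2). w l1 * w l2) p) p) p)
      summable_on N \<times> N \<times> N \<times> N" .
  have sum: "sum_term h summable_on N \<times> N \<times> N \<times> N"
  proof (rule abs_summable_summable, rule Infinite_Sum.abs_summable_on_comparison_test'[OF dom])
    fix p assume "p \<in> N \<times> N \<times> N \<times> N"
    then obtain k1 k2 l1 l2 where p: "p = (k1, k2, l1, l2)" and kl: "k1 \<in> N" "k2 \<in> N" "l1 \<in> N" "l2 \<in> N"
      by auto
    note pos = kl[THEN N0]
    show "norm (sum_term h p) \<le> C * (\<lambda>(k1, p). u k1 * (\<lambda>(k2, p). u k2 * (\<lambda>(l1, l2). w l1 * w l2) p) p) p"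
    proof (cases "squarefree k1 \<and> squarefree k2")
      case True
      then have kQ: "k1 \<in> Q" "k2 \<in> Q" using kl by (auto simp: Q_def)
      let ?s = "sqrt (freq k1 l1 * freq k2 l2)"
      have s: "0 < ?s" using pos by (simp add: freq_def)
      have "norm (sum_term h p) = \<bar>real_of_int (moebius k1)\<bar> * \<bar>real_of_int (moebius k2)\<bar> / (real k1 * real k2) *
          \<bar>outer_integral h k1 k2 l1 l2\<bar>"
        by (simp add: p sum_term_def abs_mult)
      also have "\<dots> \<le> 1 * 1 / (real k1 * real k2) * (C / ?s)"
        using moebius_bound[of k1] moebius_bound[of k2] True C'[OF kQ kl(3,4)]
        by (intro mult_mono divide_right_mono) auto
      also have "\<dots> = C * (1 / (real k1 * real k2 * ?s))" by simp
      also have "\<dots> \<le> C * (1 / (sqrt (real l1) * sqrt (real l2)))"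
        using sqrt_freq_mult_ge[OF pos(1,2), of l1 l2] pos s C(1)
        by (intro mult_left_mono divide_left_mono) (auto simp: field_simps)
      also have "\<dots> = C * (u k1 * (u k2 * (w l1 * w l2)))"
        using True by (simp add: u_def w_def)
      finally show ?thesis by (simp add: p)
    next
      case False
      then have "moebius k1 = 0 \<or> moebius k2 = 0" by (auto simp: moebius_def)
      then show ?thesis using C(1) uw by (auto simp: p sum_term_def)
    qed
  qed
  have "0 \<le> infsum (sum_term h) (N \<times> N \<times> N \<times> N)"
  proof (rule infsum_nonneg_if_boxes_nonneg[OF sum])
    fix X assume X: "finite X" "X \<subseteq> N"
    define c where "c i = real_of_int (moebius (fst i)) / real (fst i)" for i :: "nat \<times> nat"
    have "0 \<le> (\<Sum>i\<in>X \<times> X. \<Sum>j\<in>X \<times> X. c i * c j * outer_integral h (fst i) (fst j) (snd i) (snd j))"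
    proof (rule quadratic_form_nonneg[where a = "\<lambda>i. freq (fst i) (snd i)"])
      show "finite (X \<times> X)" using X by simp
      fix i assume i: "i \<in> X \<times> X"
      with X(2) have "fst i \<in> N" "snd i \<in> N" by auto
      from this[THEN N0] show "0 < freq (fst i) (snd i)" by (simp add: freq_def)
      fix j assume "j \<in> X \<times> X"
      with i X(2) have "fst i \<in> N" "fst j \<in> N" "snd i \<in> N" "snd j \<in> N" by auto
      from lim[OF this] show "(log_form (?cos (fst i) (snd i)) (?cos (fst j) (snd j)) \<longlongrightarrow>
          outer_integral h (fst i) (fst j) (snd i) (snd j)) at_top"
        by (simp only: op)
    qed
    also have "\<dots> = (\<Sum>k1\<in>X. \<Sum>l1\<in>X. \<Sum>k2\<in>X. \<Sum>l2\<in>X. sum_term h (k1, k2, l1, l2))"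
      by (simp add: sum.cartesian_product' c_def sum_term_def)
    also have "\<dots> = (\<Sum>k1\<in>X. \<Sum>k2\<in>X. \<Sum>l1\<in>X. \<Sum>l2\<in>X. sum_term h (k1, k2, l1, l2))"
      by (intro sum.cong refl sum.swap)
    also have "\<dots> = sum (sum_term h) (X \<times> X \<times> X \<times> X)"
      by (simp add: sum.cartesian_product')
    finally show "0 \<le> sum (sum_term h) (X \<times> X \<times> X \<times> X)" .
  qed
  with sum lim_ex show ?thesis by blast
qed

end
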